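(* Let $n \ge 1$ and let $T \subset \mathbb{Z}^n$ be a tile. Then there exists $d \ge n$ such that $T$ tiles $\mathbb{Z}^d$.
   Context: A tile is a finite non-empty subset of $\mathbb{Z}^n$ for some $n$. For $d \ge n$, regard $T$ as a subset of $\mathbb{Z}^d$ via the embedding $x \mapsto (x,0,\dots,0)$. A copy of $T$ in $\mathbb{Z}^d$ is a subset of $\mathbb{Z}^d$ isometric to $T$ (with respect to the Euclidean metric). We say $T$ tiles $\mathbb{Z}^d$ if $\mathbb{Z}^d$ can be partitioned into copies of $T$. *)

theory Defs
  imports Complex_Main
begin

text \<open>Points of Z^d are represented as functions nat => int vanishing at all
coordinates i >= d. Then Z^n is literally a subset of Z^d for d >= n, which is
exactly the embedding x |-> (x,0,...,0).\<close>

definition zspace :: "nat \<Rightarrow> (nat \<Rightarrow> int) set" where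
  "zspace d = {x. \<forall>i\<ge>d. x i = 0}"

definition edist :: "nat \<Rightarrow> (nat \<Rightarrow> int) \<Rightarrow> (nat \<Rightarrow> int) \<Rightarrow> real" where
  "edist d x y = sqrt (\<Sum>i<d. (real_of_int (x i - y i))\<^sup>2)"

definition is_tile :: "nat \<Rightarrow> (nat \<Rightarrow> int) set \<Rightarrow> bool" where
  "is_tile n T \<longleftrightarrow> finite T \<and> T \<noteq> {} \<and> T \<subseteq> zspace n"

definition is_copy :: "nat \<Rightarrow> (nat \<Rightarrow> int) set \<Rightarrow> (nat \<Rightarrow> int) set \<Rightarrow> bool" where
  "is_copy d T S \<longleftrightarrow> S \<subseteq> zspace d \<and>
     (\<exists>f. bij_betw f T S \<and> (\<forall>x\<in>T. \<forall>y\<in>T. edist d (f x) (f y) = edist d x y))"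

definition tiles :: "(nat \<Rightarrow> int) set \<Rightarrow> nat \<Rightarrow> bool" where
  "tiles T d \<longleftrightarrow> (\<exists>P. (\<forall>S\<in>P. is_copy d T S) \<and> \<Union>P = zspace d \<and>
      (\<forall>A\<in>P. \<forall>B\<in>P. A \<noteq> B \<longrightarrow> A \<inter> B = {}))"

end

theory Submission
  imports Defs "HOL-Library.Disjoint_Sets" "HOL-Library.FuncSet"
begin

text \<open>
  A generic linear map sends \<open>T\<close> injectively to a set \<open>A\<close> of \<open>k\<close> integers, and a tiling of \<open>Z^J\<close> by
  translates of \<open>A\<close> along the coordinate axes pulls back to a tiling by copies of \<open>T\<close>. Likewise it
  suffices to tile a product of finite abelian groups by images of \<open>A\<close> under affine maps.

  On a cyclic group \<open>S\<close> of suitable order, all translates of \<open>A\<close> cover each point \<open>k\<close> times, and a linear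
  recurrence modulo \<open>k\<close>, which is eventually periodic, gives a multiset of translates covering each
  point \<open>1\<close> modulo \<open>k\<close> times. Combining them in the two factors of \<open>B = S \<times> S\<close> gives coverings of \<open>B\<close> of
  constant multiplicity \<open>1 + kb\<close> and \<open>kb\<close>. With gadgets in further coordinates that can be
  completed by an arbitrary one of many disjoint sheets, these coverings are spread out into tilings,
  and yield for every point \<open>y\<close> of \<open>S^d\<close> a set \<open>W\<close> containing \<open>y\<close> such that both \<open>B \<times> W\<close> and \<open>B \<times> (W - {y})\<close>
  can be tiled. In the presence of \<open>B\<close>, single points can thus be added or removed freely.

  Let \<open>H\<close> be a group with a tileable subset \<open>U\<close> such that every \<open>v\<close> outside \<open>U\<close> lies in a tile whose other
  points are in \<open>U\<close>. Then \<open>B \<times> (U \<times> S^d \<union> {p})\<close> can be tiled for every single point \<open>p\<close> of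
  \<open>V = (H - U) \<times> S^d\<close>. In a power of \<open>H \<times> S^d\<close> with more than \<open>card V\<close> factors, each point with all
  coordinates in \<open>V\<close> can be assigned to a coordinate direction such that every line in that direction
  gets at most one point, so all of them are absorbed.
\<close>

section \<open>Tilings of products\<close>

text \<open>Stated for an arbitrary family of sets, so that one calculus serves the finite groups,
  the integer lattice and the copies of \<open>T\<close>.\<close>

definition tileable :: "'a set set \<Rightarrow> 'a set \<Rightarrow> bool" where
  "tileable F X \<longleftrightarrow> (\<exists>P\<subseteq>F. disjoint P \<and> \<Union>P = X)"

definition prod_tiles :: "'a set set \<Rightarrow> 'b set set \<Rightarrow> ('a \<times> 'b) set set" where
  "prod_tiles F G = {B \<times> {y} | B y. B \<in> F} \<union> {{x} \<times> C | x C. C \<in> G}"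

definition pow_tiles :: "'a set set \<Rightarrow> nat \<Rightarrow> (nat \<Rightarrow> 'a) set set" where
  "pow_tiles F d = {(\<lambda>b. f(i := b)) ` B | f i B. i < d \<and> B \<in> F}"

abbreviation power_set :: "'a set \<Rightarrow> nat \<Rightarrow> (nat \<Rightarrow> 'a) set" where
  "power_set \<Omega> d \<equiv> PiE {..<d} (\<lambda>_. \<Omega>)"

lemma tileable_empty: "tileable F {}"
  unfolding tileable_def by (rule exI[of _ "{}"]) auto

lemma tileable_tile: "B \<in> F \<Longrightarrow> tileable F B"
  unfolding tileable_def by (rule exI[of _ "{B}"]) auto

lemma tileable_UN:
  assumes "\<And>i. i \<in> I \<Longrightarrow> tileable F (X i)"
    and "\<And>i j. i \<in> I \<Longrightarrow> j \<in> I \<Longrightarrow> i \<noteq> j \<Longrightarrow> X i \<inter> X j = {}"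
  shows "tileable F (\<Union>i\<in>I. X i)"
proof -
  have "\<forall>i\<in>I. \<exists>P. P \<subseteq> F \<and> disjoint P \<and> \<Union>P = X i"
    using assms(1) unfolding tileable_def by blast
  then obtain P where P: "\<And>i. i \<in> I \<Longrightarrow> P i \<subseteq> F \<and> disjoint (P i) \<and> \<Union>(P i) = X i"
    by metis
  have "A \<inter> B = {}" if "A \<in> P i" "B \<in> P j" "i \<in> I" "j \<in> I" "A \<noteq> B" for A B i j
  proof (cases "i = j")
    case True
    then show ?thesis using P[of i] that by (auto simp: disjoint_def)
  next
    case False
    have "A \<subseteq> X i" "B \<subseteq> X j" using P that by blast+
    then show ?thesis using assms(2)[of i j] that False by blast
  qed
  then have "disjoint (\<Union>i\<in>I. P i)"
    unfolding disjoint_def by blast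
  moreover have "(\<Union>i\<in>I. P i) \<subseteq> F" using P by blast
  moreover have "\<Union>(\<Union>i\<in>I. P i) = (\<Union>i\<in>I. X i)"
  proof -
    have "\<Union>(\<Union>i\<in>I. P i) = (\<Union>i\<in>I. \<Union>(P i))" by blast
    then show ?thesis using P by simp
  qed
  ultimately show ?thesis unfolding tileable_def by blast
qed

lemma tileable_Un:
  assumes "tileable F X" "tileable F Y" "X \<inter> Y = {}"
  shows "tileable F (X \<union> Y)"
proof -
  have "tileable F (\<Union>b\<in>UNIV. if b then X else Y)"
    by (rule tileable_UN) (use assms in \<open>auto split: if_splits\<close>)
  moreover have "(\<Union>b\<in>UNIV. if b then X else Y) = X \<union> Y"
    by (auto simp: UNIV_bool)
  ultimately show ?thesis by simp
qed

lemma tileable_image: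
  assumes "tileable F X" "inj_on g X" "\<And>B. B \<in> F \<Longrightarrow> B \<subseteq> X \<Longrightarrow> tileable G (g ` B)"
  shows "tileable G (g ` X)"
proof -
  obtain P where P: "P \<subseteq> F" "disjoint P" "\<Union>P = X"
    using assms(1) unfolding tileable_def by blast
  have "tileable G (\<Union>B\<in>P. g ` B)"
  proof (rule tileable_UN)
    fix B assume "B \<in> P"
    then show "tileable G (g ` B)" using P assms(3) by blast
  next
    fix A B assume *: "A \<in> P" "B \<in> P" "A \<noteq> B"
    then have "A \<inter> B = {}" using P(2) by (auto simp: disjoint_def)
    moreover have "A \<subseteq> X" "B \<subseteq> X" using * P(3) by auto
    ultimately show "g ` A \<inter> g ` B = {}"
      using assms(2) inj_on_image_Int by (metis image_empty)
  qed
  moreover have "(\<Union>B\<in>P. g ` B) = g ` X" using P(3) by blast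
  ultimately show ?thesis by simp
qed

text \<open>The tiling of the fibre may vary with \<open>x\<close>; \<open>tileable_sheets\<close>
  depends on this freedom.\<close>

lemma tileable_Sigma:
  assumes "\<And>x. x \<in> X \<Longrightarrow> tileable G (Y x)"
  shows "tileable (prod_tiles F G) (Sigma X Y)"
proof -
  have "tileable (prod_tiles F G) (\<Union>x\<in>X. Pair x ` Y x)"
  proof (rule tileable_UN)
    fix x assume "x \<in> X"
    show "tileable (prod_tiles F G) (Pair x ` Y x)"
    proof (rule tileable_image[OF assms[OF \<open>x \<in> X\<close>]])
      show "inj_on (Pair x) (Y x)" by (auto simp: inj_on_def)
      fix B assume "B \<in> G"
      then have "{x} \<times> B \<in> prod_tiles F G" unfolding prod_tiles_def by blast
      moreover have "{x} \<times> B = Pair x ` B" by auto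
      ultimately show "tileable (prod_tiles F G) (Pair x ` B)"
        using tileable_tile by metis
    qed
  qed auto
  moreover have "(\<Union>x\<in>X. Pair x ` Y x) = Sigma X Y" by auto
  ultimately show ?thesis by simp
qed

lemma tileable_Times:
  assumes "tileable F X"
  shows "tileable (prod_tiles F G) (X \<times> Y)"
proof -
  have "tileable (prod_tiles F G) (\<Union>y\<in>Y. (\<lambda>x. (x, y)) ` X)"
  proof (rule tileable_UN)
    fix y assume "y \<in> Y"
    show "tileable (prod_tiles F G) ((\<lambda>x. (x, y)) ` X)"
    proof (rule tileable_image[OF assms])
      show "inj_on (\<lambda>x. (x, y)) X" by (auto simp: inj_on_def)
      fix B assume "B \<in> F"
      then have "B \<times> {y} \<in> prod_tiles F G" unfolding prod_tiles_def by blast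
      moreover have "B \<times> {y} = (\<lambda>x. (x, y)) ` B" by auto
      ultimately show "tileable (prod_tiles F G) ((\<lambda>x. (x, y)) ` B)"
        using tileable_tile by metis
    qed
  qed auto
  moreover have "(\<Union>y\<in>Y. (\<lambda>x. (x, y)) ` X) = X \<times> Y" by auto
  ultimately show ?thesis by simp
qed

text \<open>The members of \<open>L\<close> cover every point of \<open>B\<close> the same number of times. Placing the \<open>i\<close>-th one
  along the sheet \<open>Z i\<close> leaves exactly \<open>q\<close> sheets open over each point, one for each filler \<open>E g\<close>.\<close>

lemma tileable_sheets:
  fixes L :: "'a set list" and Z E :: "nat \<Rightarrow> 'b set"
  assumes L: "\<And>C. C \<in> set L \<Longrightarrow> tileable F C \<and> C \<subseteq> B"
    and cov: "\<And>\<omega>. \<omega> \<in> B \<Longrightarrow> length (filter (\<lambda>C. \<omega> \<in> C) L) = c"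
    and len: "length L = c + q"
    and EZ: "\<And>g i. g < q \<Longrightarrow> i < length L \<Longrightarrow> tileable K (E g \<union> Z i)"
    and EE: "\<And>g h. g < q \<Longrightarrow> h < q \<Longrightarrow> g \<noteq> h \<Longrightarrow> E g \<inter> E h = {}"
    and ZZ: "\<And>i j. i < length L \<Longrightarrow> j < length L \<Longrightarrow> i \<noteq> j \<Longrightarrow> Z i \<inter> Z j = {}"
    and EZ0: "\<And>g i. g < q \<Longrightarrow> i < length L \<Longrightarrow> E g \<inter> Z i = {}"
  shows "tileable (prod_tiles F K) (B \<times> ((\<Union>g<q. E g) \<union> (\<Union>i<length L. Z i)))"
proof -
  \<comment> \<open>\<open>N \<omega>\<close> indexes the sheets that stay open over
    \<open>\<omega>\<close>: of the \<open>c + q\<close> members exactly \<open>c\<close> contain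
    \<open>\<omega>\<close>, so \<open>q\<close> sheets remain.\<close>
  define N where "N \<omega> = {i. i < length L \<and> \<omega> \<notin> L ! i}" for \<omega>
  have finN: "finite (N \<omega>)" for \<omega> unfolding N_def by auto
  have cardN: "card (N \<omega>) = q" if "\<omega> \<in> B" for \<omega>
  proof -
    have "card (N \<omega>) = length (filter (\<lambda>C. \<omega> \<notin> C) L)"
      unfolding N_def by (simp add: length_filter_conv_card)
    moreover have "length (filter (\<lambda>C. \<omega> \<in> C) L) + length (filter (\<lambda>C. \<omega> \<notin> C) L) = length L"
      by (rule sum_length_filter_compl)
    ultimately show ?thesis using cov[OF that] len by simp
  qed
  define Y where "Y \<omega> = (\<Union>g<q. E g) \<union> (\<Union>i\<in>N \<omega>. Z i)" for \<omega>
  have Y: "tileable K (Y \<omega>)" if \<omega>: "\<omega> \<in> B" for \<omega>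
  proof -
    \<comment> \<open>Any bijection will do, because every filler can be completed by every
      sheet.\<close>
    obtain h where h: "bij_betw h {..<q} (N \<omega>)"
      using ex_bij_betw_nat_finite[OF finN, of \<omega>] cardN[OF \<omega>] by (metis atLeast0LessThan)
    have hN: "h g < length L" if "g < q" for g
      using bij_betwE[OF h] that unfolding N_def by auto
    have "tileable K (\<Union>g\<in>{..<q}. E g \<union> Z (h g))"
    proof (rule tileable_UN)
      fix g g' assume *: "g \<in> {..<q}" "g' \<in> {..<q}" "g \<noteq> g'"
      have "h g \<noteq> h g'" using bij_betw_imp_inj_on[OF h] * by (auto simp: inj_on_def)
      then show "(E g \<union> Z (h g)) \<inter> (E g' \<union> Z (h g')) = {}"
        using * EE[of g g'] EZ0[of g "h g'"] EZ0[of g' "h g"] ZZ[of "h g" "h g'"] hN by auto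
    qed (use EZ hN in auto)
    moreover have "(\<Union>g\<in>{..<q}. E g \<union> Z (h g)) = Y \<omega>"
      unfolding Y_def bij_betw_imp_surj_on[OF h, symmetric] by auto
    ultimately show ?thesis by simp
  qed
  have 1: "tileable (prod_tiles F K) (Sigma B Y)"
    by (rule tileable_Sigma) (rule Y)
  have 2: "tileable (prod_tiles F K) (\<Union>i\<in>{..<length L}. (L ! i) \<times> Z i)"
  proof (rule tileable_UN)
    fix i assume "i \<in> {..<length L}"
    then show "tileable (prod_tiles F K) ((L ! i) \<times> Z i)"
      using L by (intro tileable_Times) simp
  next
    fix i j assume "i \<in> {..<length L}" "j \<in> {..<length L}" "i \<noteq> j"
    then show "L ! i \<times> Z i \<inter> L ! j \<times> Z j = {}" using ZZ[of i j] by auto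
  qed
  have 3: "Sigma B Y \<inter> (\<Union>i\<in>{..<length L}. (L ! i) \<times> Z i) = {}"
  proof -
    have False if y: "y \<in> Y \<omega>" and "\<omega> \<in> L ! i" "i < length L" "y \<in> Z i" for \<omega> y i
    proof -
      consider g where "g < q" "y \<in> E g" | j where "j \<in> N \<omega>" "y \<in> Z j"
        using y unfolding Y_def by auto
      then show False
      proof cases
        case 1 then show ?thesis using EZ0[of g i] that by auto
      next
        case 2
        then have "j \<noteq> i" "j < length L" using that unfolding N_def by auto
        then show ?thesis using ZZ[of i j] 2 that by auto
      qed
    qed
    then show ?thesis by auto
  qed
  have 4: "Sigma B Y \<union> (\<Union>i\<in>{..<length L}. (L ! i) \<times> Z i)
      = B \<times> ((\<Union>g<q. E g) \<union> (\<Union>i<length L. Z i))"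
  proof -
    have "L ! i \<subseteq> B" if "i < length L" for i using L that by simp
    then show ?thesis unfolding Y_def N_def by blast
  qed
  show ?thesis using tileable_Un[OF 1 2 3] unfolding 4 .
qed

section \<open>Adding and removing a point\<close>

text \<open>The points that differ from \<open>y\<close> exactly in the coordinates of \<open>J\<close>, with new values in \<open>C\<close>. Tilings
  by axis-parallel tiles then reduce to pairing \<open>J\<close> with \<open>insert j J\<close>.\<close>

definition cube :: "('i \<Rightarrow> 'a) \<Rightarrow> ('i \<Rightarrow> 'a set) \<Rightarrow> 'i set \<Rightarrow> ('i \<Rightarrow> 'a) set" where
  "cube y C J = {f. (\<forall>j\<in>J. f j \<in> C j - {y j}) \<and> (\<forall>j. j \<notin> J \<longrightarrow> f j = y j)}"

lemma cube_support: "f \<in> cube y C J \<Longrightarrow> {j. f j \<noteq> y j} = J"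
  unfolding cube_def by auto

lemma cube_disjoint: "J \<noteq> J' \<Longrightarrow> cube y C J \<inter> cube y C J' = {}"
  using cube_support[of _ y C J] cube_support[of _ y C J'] by (metis disjoint_iff)

lemma cube_empty: "cube y C {} = {y}"
  unfolding cube_def by auto

text \<open>The points of \<open>cube y C J\<close> have value \<open>y j\<close> at
  \<open>j\<close>. The tile through such a point in direction \<open>j\<close> meets
  \<open>cube y C J\<close> in that point only and has all its other points in
  \<open>cube y C (insert j J)\<close>.\<close>

lemma tileable_cube_pair:
  assumes "j \<notin> J" "j < d" "C j \<in> F" "y j \<in> C j"
  shows "tileable (pow_tiles F d) (cube y C J \<union> cube y C (insert j J))"
proof -
  have "tileable (pow_tiles F d) (\<Union>f\<in>cube y C J. (\<lambda>b. f(j := b)) ` C j)"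
  proof (rule tileable_UN)
    fix f assume "f \<in> cube y C J"
    show "tileable (pow_tiles F d) ((\<lambda>b. f(j := b)) ` C j)"
      by (rule tileable_tile) (use assms in \<open>auto simp: pow_tiles_def\<close>)
  next
    fix f g assume fg: "f \<in> cube y C J" "g \<in> cube y C J" "f \<noteq> g"
    have "f j = g j" using fg assms(1) unfolding cube_def by auto
    then have "f(j := b) \<noteq> g(j := b')" for b b'
      using fg(3) by (metis fun_upd_triv fun_upd_upd)
    then show "(\<lambda>b. f(j := b)) ` C j \<inter> (\<lambda>b. g(j := b)) ` C j = {}" by auto
  qed
  moreover have "(\<Union>f\<in>cube y C J. (\<lambda>b. f(j := b)) ` C j) = cube y C J \<union> cube y C (insert j J)"
  proof (intro equalityI subsetI)
    fix h assume "h \<in> (\<Union>f\<in>cube y C J. (\<lambda>b. f(j := b)) ` C j)"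
    then obtain f b where "f \<in> cube y C J" "b \<in> C j" "h = f(j := b)" by auto
    then show "h \<in> cube y C J \<union> cube y C (insert j J)"
      using assms(1) unfolding cube_def by (cases "b = y j") auto
  next
    fix h assume h: "h \<in> cube y C J \<union> cube y C (insert j J)"
    then have "h(j := y j) \<in> cube y C J" "h j \<in> C j"
      using assms unfolding cube_def by auto
    moreover have "h = (h(j := y j))(j := h j)" by simp
    ultimately show "h \<in> (\<Union>f\<in>cube y C J. (\<lambda>b. f(j := b)) ` C j)" by blast
  qed
  ultimately show ?thesis by simp
qed

abbreviation cubes :: "('i \<Rightarrow> 'a) \<Rightarrow> ('i \<Rightarrow> 'a set) \<Rightarrow> 'i set set \<Rightarrow> ('i \<Rightarrow> 'a) set" where
  "cubes y C \<J> \<equiv> (\<Union>J\<in>\<J>. cube y C J)"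

lemma cubes_disjoint:
  assumes "\<I> \<inter> \<J> = {}"
  shows "cubes y C \<I> \<inter> cubes y C \<J> = {}"
proof -
  have False if "I \<in> \<I>" "J \<in> \<J>" "f \<in> cube y C I" "f \<in> cube y C J" for f I J
  proof -
    have "I = J" using cube_support[OF that(3)] cube_support[OF that(4)] by simp
    then show False using that assms by blast
  qed
  then show ?thesis by (auto simp: disjoint_iff)
qed

lemma tileable_cubes_Un:
  assumes "tileable F (cubes y C \<I>)" "tileable F (cubes y C \<J>)" "\<I> \<inter> \<J> = {}"
  shows "tileable F (cubes y C (\<I> \<union> \<J>))"
  using tileable_Un[OF assms(1,2) cubes_disjoint[OF assms(3)]] by (simp add: UN_Un)

lemma tileable_cubes_UN:
  assumes "\<And>i. i \<in> I \<Longrightarrow> tileable F (cubes y C (\<J> i))"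
    and "\<And>i j. i \<in> I \<Longrightarrow> j \<in> I \<Longrightarrow> i \<noteq> j \<Longrightarrow> \<J> i \<inter> \<J> j = {}"
  shows "tileable F (cubes y C (\<Union>i\<in>I. \<J> i))"
  unfolding UN_UN_flatten by (rule tileable_UN[OF assms(1) cubes_disjoint[OF assms(2)]])

lemma tileable_cubes_pair:
  assumes "j \<notin> J" "j < d" "C j \<in> F" "y j \<in> C j"
  shows "tileable (pow_tiles F d) (cubes y C {J, insert j J})"
  using tileable_cube_pair[of j J d C F y] assms by simp

text \<open>The family consisting of \<open>{}\<close>, the \<open>{2 * i}\<close> and the \<open>{2 * i, 2 * i + 1}\<close> can be paired up as soon as any
  one sheet is left out. Hence its translate by a fresh coordinate \<open>e\<close>, the filler, can be paired up
  together with any one sheet: \<open>sheet i\<close> is matched with \<open>insert e (sheet i)\<close>.\<close>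

definition sheet :: "nat \<Rightarrow> nat set" where
  "sheet i = (if i = 0 then {} else {2 * i, 2 * i + 1})"

definition filler :: "nat \<Rightarrow> nat \<Rightarrow> nat set set" where
  "filler s e = (\<Union>i\<in>{..<s}. {insert e (sheet i)}) \<union> (\<Union>i\<in>{1..<s}. {{e, 2 * i}})"

lemma sheet_inj:
  assumes "sheet i = sheet j"
  shows "i = j"
proof -
  have mem: "2 * i \<in> sheet j \<longleftrightarrow> i = j" if "i \<noteq> 0" for i j
    using that by (simp add: sheet_def) presburger
  have "i = 0 \<longleftrightarrow> j = 0" using arg_cong[OF assms, of "\<lambda>J. J = {}"] by (simp add: sheet_def split: if_splits)
  then show ?thesis using mem[of i i] mem[of i j] assms by auto
qed

lemma sheet_less: "i < s \<Longrightarrow> sheet i \<subseteq> {..<2 * s}"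
  by (auto simp: sheet_def)

text \<open>Once \<open>sheet i\<close> takes \<open>insert e (sheet i)\<close> as partner, the set
  \<open>{e, 2 * i}\<close> has lost its own and is paired with \<open>{e}\<close> instead; all
  other indices keep the standard pairing. For \<open>i = 0\<close> the set \<open>{e}\<close> is
  itself the partner of the sheet.\<close>

lemma filler_eq:
  assumes "i < s" "2 * s \<le> e"
  shows "filler s e \<union> {sheet i} = {sheet i, insert e (sheet i)}
    \<union> ((if i = 0 then {} else {{e}, {e, 2 * i}})
    \<union> (\<Union>j\<in>{1..<s} - {i}. {{e, 2 * j}, insert (2 * j + 1) {e, 2 * j}}))"
    (is "?L = ?R")
proof -
  have split: "{..<s} = insert i (insert 0 ({1..<s} - {i}))" using assms(1) by auto
  have 1: "(\<Union>j\<in>{..<s}. {insert e (sheet j)}) = {insert e (sheet i)} \<union> {{e}}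
      \<union> (\<Union>j\<in>{1..<s} - {i}. {insert (2 * j + 1) {e, 2 * j}})"
    unfolding split by (auto simp: sheet_def insert_commute)
  have 2: "i \<noteq> 0 \<Longrightarrow> {1..<s} = insert i ({1..<s} - {i})" using assms(1) by auto
  show ?thesis
  proof (cases "i = 0")
    case True
    then show ?thesis unfolding filler_def 1 by (auto simp: sheet_def)
  next
    case False
    have 3: "(\<Union>j\<in>{1..<s}. {{e, 2 * j}}) = {{e, 2 * i}} \<union> (\<Union>j\<in>{1..<s} - {i}. {{e, 2 * j}})"
      using 2[OF False] by (metis (no_types, lifting) UN_insert)
    show ?thesis unfolding filler_def 1 3 using False by auto
  qed
qed

lemma tileable_filler_sheet:
  assumes "i < s" "2 * s \<le> e" "e < d"
    and C: "\<And>j. j < d \<Longrightarrow> C j \<in> F \<and> y j \<in> C j"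
  shows "tileable (pow_tiles F d) (cubes y C (filler s e \<union> {sheet i}))"
proof -
  have lt: "2 * j + 1 < e" if "j < s" for j using that assms(2) by simp
  have e: "e \<notin> sheet i" using sheet_less[OF assms(1)] assms(2) by auto
  have t1: "tileable (pow_tiles F d) (cubes y C {sheet i, insert e (sheet i)})"
    by (rule tileable_cubes_pair) (use C assms(3) e in auto)
  have t2: "tileable (pow_tiles F d) (cubes y C (if i = 0 then {} else {{e}, {e, 2 * i}}))"
  proof (cases "i = 0")
    case True then show ?thesis by (simp add: tileable_empty)
  next
    case False
    have "tileable (pow_tiles F d) (cubes y C {{e}, insert (2 * i) {e}})"
      by (rule tileable_cubes_pair) (use C[of "2 * i"] assms(3) lt[OF assms(1)] in auto)
    then show ?thesis using False by (simp add: insert_commute)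
  qed
  have t3: "tileable (pow_tiles F d)
      (cubes y C (\<Union>j\<in>{1..<s} - {i}. {{e, 2 * j}, insert (2 * j + 1) {e, 2 * j}}))"
  proof (rule tileable_cubes_UN)
    fix j assume "j \<in> {1..<s} - {i}"
    then have "2 * j + 1 < e" using lt by auto
    then show "tileable (pow_tiles F d) (cubes y C {{e, 2 * j}, insert (2 * j + 1) {e, 2 * j}})"
      by (intro tileable_cubes_pair) (use C[of "2 * j + 1"] assms(3) in auto)
  next
    fix j l assume "j \<in> {1..<s} - {i}" "l \<in> {1..<s} - {i}" "j \<noteq> l"
    then have "2 * j \<notin> {e, 2 * l, 2 * l + 1}" using lt[of j]
      by simp
    then show "{{e, 2 * j}, insert (2 * j + 1) {e, 2 * j}}
      \<inter> {{e, 2 * l}, insert (2 * l + 1) {e, 2 * l}} = {}"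
      by (auto simp: set_eq_iff)
  qed
  define R where "R = (\<Union>j\<in>{1..<s} - {i}. {{e, 2 * j}, insert (2 * j + 1) {e, 2 * j}})"
  \<comment> \<open>An even element \<open>2 * j\<close> with \<open>j\<close> different from
    \<open>i\<close> marks the sets of \<open>R\<close> and separates them from the remaining
    pairs.\<close>
  have R: "\<exists>j. 2 * j \<in> A \<and> e \<in> A \<and> 2 * j \<noteq> e \<and> 2 * j \<noteq> 2 * i \<and> 2 * j \<notin> sheet i"
    if A: "A \<in> R" for A
  proof -
    obtain j where j: "j \<in> {1..<s} - {i}" "A \<in> {{e, 2 * j}, insert (2 * j + 1) {e, 2 * j}}"
      using A unfolding R_def by blast
    have "2 * j \<notin> sheet i" using j(1) by (auto simp: sheet_def; presburger)
    then show ?thesis using j lt[of j] by (intro exI[of _ j]) auto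
  qed
  have d23: "(if i = 0 then {} else {{e}, {e, 2 * i}}) \<inter> R = {}"
  proof -
    have "{e} \<notin> R" "{e, 2 * i} \<notin> R" using R by blast+
    then show ?thesis by simp
  qed
  have d1: "{sheet i, insert e (sheet i)} \<inter> ((if i = 0 then {} else {{e}, {e, 2 * i}}) \<union> R) = {}"
  proof -
    have "sheet i \<notin> R" "insert e (sheet i) \<notin> R" using R e by blast+
    moreover have "sheet i \<notin> {{e}, {e, 2 * i}}" using e by blast
    moreover have "insert e (sheet i) \<notin> {{e}, {e, 2 * i}}" if "i \<noteq> 0"
    proof -
      have "2 * i + 1 \<in> sheet i" "2 * i + 1 \<notin> {e, 2 * i}"
        using that lt[OF assms(1)] by (auto simp: sheet_def)
      then show ?thesis by blast
    qed
    ultimately show ?thesis by (cases "i = 0") simp_all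
  qed
  show ?thesis unfolding filler_eq[OF assms(1,2)]
    by (intro tileable_cubes_Un t1 t2 t3 d1[unfolded R_def] d23[unfolded R_def])
qed

text \<open>\<open>tileable_sheets\<close> is applied twice with the same fillers: to
  \<open>L1\<close> with the sheets \<open>0, ..., s - 1\<close> and to \<open>L2\<close> with the
  sheets \<open>1, ..., s - 1\<close>, where \<open>s = Suc c + q\<close>. Both leave
  \<open>q\<close> sheets open, and the omitted sheet \<open>0\<close> is the single point
  \<open>y\<close>. Of the \<open>d\<close> coordinates, \<open>2 * s\<close> serve the sheets and
  \<open>q\<close> are the fresh ones of the fillers.\<close>

lemma ex_gadget:
  fixes F :: "'a set set" and \<Omega> :: "'a set" and FB :: "'b set set" and B :: "'b set"
  assumes L1: "\<And>C. C \<in> set L1 \<Longrightarrow> tileable FB C \<and> C \<subseteq> B"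
    and L2: "\<And>C. C \<in> set L2 \<Longrightarrow> tileable FB C \<and> C \<subseteq> B"
    and cov1: "\<And>\<omega>. \<omega> \<in> B \<Longrightarrow> length (filter (\<lambda>C. \<omega> \<in> C) L1) = Suc c"
    and cov2: "\<And>\<omega>. \<omega> \<in> B \<Longrightarrow> length (filter (\<lambda>C. \<omega> \<in> C) L2) = c"
    and len: "length L1 = Suc c + q" "length L2 = c + q"
    and F: "\<And>x. x \<in> \<Omega> \<Longrightarrow> \<exists>C\<in>F. x \<in> C \<and> C \<subseteq> \<Omega>"
    and d: "d = 2 * (Suc c + q) + q" and y: "y \<in> power_set \<Omega> d"
  shows "\<exists>W \<subseteq> power_set \<Omega> d. y \<in> W
    \<and> tileable (prod_tiles FB (pow_tiles F d)) (B \<times> W)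
    \<and> tileable (prod_tiles FB (pow_tiles F d)) (B \<times> (W - {y}))"
proof -
  define s where "s = Suc c + q"
  have "\<forall>j\<in>{..<d}. \<exists>C. C \<in> F \<and> y j \<in> C \<and> C \<subseteq> \<Omega>" using F y by blast
  then obtain C where C: "\<And>j. j < d \<Longrightarrow> C j \<in> F \<and> y j \<in> C j \<and> C j \<subseteq> \<Omega>"
    by (metis lessThan_iff)
  define Z where "Z i = cube y C (sheet i)" for i
  define E where "E g = cubes y C (filler s (2 * s + g))" for g
  \<comment> \<open>The coordinates from \<open>2 * s\<close> on identify the filler to which an
    index set belongs, and sheets avoid them. This separates the fillers from each other and from
    the sheets.\<close>
  have e_in: "J \<inter> {2 * s..} = {2 * s + g}" if "J \<in> filler s (2 * s + g)" for J g
    using that sheet_less[of _ s] by (fastforce simp: filler_def)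
  have sh: "sheet i \<inter> {2 * s..} = {}" if "i < s" for i
    using sheet_less[OF that] by auto
  have EZ: "tileable (pow_tiles F d) (E g \<union> Z i)" if "g < q" "i < s" for g i
  proof -
    have "tileable (pow_tiles F d) (cubes y C (filler s (2 * s + g) \<union> {sheet i}))"
      by (rule tileable_filler_sheet) (use that d C in \<open>auto simp: s_def\<close>)
    then show ?thesis by (simp add: E_def Z_def Un_commute)
  qed
  have EE: "E g \<inter> E h = {}" if "g \<noteq> h" for g h
  proof -
    have False if "J \<in> filler s (2 * s + g)" "J \<in> filler s (2 * s + h)" for J
      using e_in[OF that(1)] e_in[OF that(2)] \<open>g \<noteq> h\<close> by simp
    then show ?thesis unfolding E_def by (intro cubes_disjoint) blast
  qed
  have ZZ: "Z i \<inter> Z j = {}" if "i \<noteq> j" for i j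
    unfolding Z_def using that sheet_inj by (intro cube_disjoint) blast
  have EZ0: "E g \<inter> Z i = {}" if "i < s" for g i
  proof -
    have "cubes y C (filler s (2 * s + g)) \<inter> cubes y C {sheet i} = {}"
      using sh[OF that] e_in[of "sheet i" g] by (intro cubes_disjoint) auto
    then show ?thesis by (simp add: E_def Z_def)
  qed
  have Z0: "Z 0 = {y}" by (simp add: Z_def sheet_def cube_empty)
  define W where "W = (\<Union>g<q. E g) \<union> (\<Union>i<length L1. Z i)"
  have len1: "length L1 = s" using len s_def by simp
  have yZ: "y \<in> Z 0" using Z0 by simp
  have 1: "tileable (prod_tiles FB (pow_tiles F d)) (B \<times> W)"
    unfolding W_def
    by (rule tileable_sheets[OF L1 cov1 len(1)]) (use EZ EE ZZ EZ0 len1 in auto)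
  have 2: "tileable (prod_tiles FB (pow_tiles F d))
      (B \<times> ((\<Union>g<q. E g) \<union> (\<Union>i<length L2. Z (Suc i))))"
    by (rule tileable_sheets[OF L2 cov2 len(2)])
      (use EZ EE ZZ EZ0 len s_def in auto)
  have 3: "W - {y} = (\<Union>g<q. E g) \<union> (\<Union>i<length L2. Z (Suc i))"
  proof -
    have "{..<length L1} = insert 0 (Suc ` {..<length L2})"
      using len by (auto simp: image_iff less_Suc_eq_0_disj)
    then have "W = (\<Union>g<q. E g) \<union> {y} \<union> (\<Union>i<length L2. Z (Suc i))"
      unfolding W_def using Z0 by auto
    moreover have "y \<notin> E g" for g using EZ0[of 0 g] yZ by (auto simp: s_def)
    moreover have "y \<notin> Z (Suc i)" for i using ZZ[of 0 "Suc i"] yZ by auto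
    ultimately show ?thesis by auto
  qed
  have cubeP: "cube y C J \<subseteq> power_set \<Omega> d" if "J \<subseteq> {..<d}" for J
  proof
    fix f assume f: "f \<in> cube y C J"
    show "f \<in> power_set \<Omega> d"
    proof (rule PiE_I)
      fix j assume "j \<in> {..<d}"
      then show "f j \<in> \<Omega>" using f C[of j] y that unfolding cube_def by (cases "j \<in> J") auto
    next
      fix j assume "j \<notin> {..<d}"
      then show "f j = undefined" using f y that unfolding cube_def by (auto simp: PiE_def extensional_def)
    qed
  qed
  have "W \<subseteq> power_set \<Omega> d"
  proof -
    have "J \<subseteq> {..<d}" if "J \<in> filler s (2 * s + g)" "g < q" for J g
      using that sheet_less[of _ s] unfolding filler_def d s_def by (fastforce simp: subset_eq)
    then have "E g \<subseteq> power_set \<Omega> d" if "g < q" for g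
      unfolding E_def using cubeP that by blast
    moreover have "Z i \<subseteq> power_set \<Omega> d" if "i < s" for i
      unfolding Z_def using cubeP sheet_less[OF that] d s_def by (metis le_add1 lessThan_subset_iff subset_trans)
    ultimately show ?thesis unfolding W_def len1 by blast
  qed
  moreover have "y \<in> W" unfolding W_def using yZ len1 s_def by auto
  ultimately show ?thesis using 1 2 3 by metis
qed

section \<open>Absorbing all points of a power\<close>

lemma tileable_insert_factor:
  assumes "tileable (prod_tiles F K) (B \<times> W)"
  shows "tileable (prod_tiles F (prod_tiles G K)) (B \<times> (Q \<times> W))"
proof -
  have "tileable (prod_tiles F (prod_tiles G K)) (\<Union>u\<in>Q. (\<lambda>(\<omega>, w). (\<omega>, u, w)) ` (B \<times> W))"
  proof (rule tileable_UN)
    fix u assume "u \<in> Q"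
    show "tileable (prod_tiles F (prod_tiles G K)) ((\<lambda>(\<omega>, w). (\<omega>, u, w)) ` (B \<times> W))"
    proof (rule tileable_image[OF assms])
      show "inj_on (\<lambda>(\<omega>, w). (\<omega>, u, w)) (B \<times> W)" by (auto simp: inj_on_def)
      fix D assume "D \<in> prod_tiles F K"
      then consider A w where "A \<in> F" "D = A \<times> {w}" | \<omega> A where "A \<in> K" "D = {\<omega>} \<times> A"
        unfolding prod_tiles_def by blast
      then show "tileable (prod_tiles F (prod_tiles G K)) ((\<lambda>(\<omega>, w). (\<omega>, u, w)) ` D)"
      proof cases
        case 1
        have "(\<lambda>(\<omega>, w). (\<omega>, u, w)) ` D = A \<times> {(u, w)}" unfolding 1 by auto
        then show ?thesis using tileable_Times[OF tileable_tile[OF 1(1)]] by metis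
      next
        case 2
        have "(\<lambda>(\<omega>, w). (\<omega>, u, w)) ` D = {\<omega>} \<times> ({u} \<times> A)" unfolding 2 by auto
        moreover have "tileable (prod_tiles F (prod_tiles G K)) ({\<omega>} \<times> ({u} \<times> A))"
          by (intro tileable_Sigma tileable_tile 2)
        ultimately show ?thesis by simp
      qed
    qed
  qed auto
  moreover have "(\<Union>u\<in>Q. (\<lambda>(\<omega>, w). (\<omega>, u, w)) ` (B \<times> W)) = B \<times> (Q \<times> W)" by force
  ultimately show ?thesis by simp
qed

text \<open>The tile \<open>C\<close> placed at height \<open>y\<close> covers \<open>(v, y)\<close>
  but uses up \<open>X \<times> {y}\<close> with \<open>X = C - {v}\<close>. Over \<open>X\<close>
  the set \<open>W - {y}\<close> therefore replaces \<open>W\<close>, over \<open>U - X\<close> all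
  of \<open>W\<close> is tiled, and at heights outside \<open>W\<close> the tiling of
  \<open>U\<close> is used.\<close>

lemma tileable_absorb_point:
  assumes U: "tileable FH U" and C: "C \<in> FH" "v \<in> C" "C - {v} \<subseteq> U" "v \<notin> U"
    and W: "W \<subseteq> Y" "y \<in> W"
    and BW: "tileable (prod_tiles FB FY) (B \<times> W)" "tileable (prod_tiles FB FY) (B \<times> (W - {y}))"
  shows "tileable (prod_tiles FB (prod_tiles FH FY)) (B \<times> (U \<times> Y \<union> {(v, y)}))"
proof -
  let ?t = "tileable (prod_tiles FB (prod_tiles FH FY))"
  define X where "X = C - {v}"
  have 1: "?t (B \<times> (C \<times> {y}))" by (intro tileable_Sigma tileable_Times tileable_tile C)
  have 2: "?t (B \<times> (U \<times> (Y - W)))" by (intro tileable_Sigma[of B] tileable_Times U)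
  have 3: "?t (B \<times> ((U - X) \<times> W))" by (rule tileable_insert_factor[OF BW(1)])
  have 4: "?t (B \<times> (X \<times> (W - {y})))" by (rule tileable_insert_factor[OF BW(2)])
  have "?t (B \<times> (C \<times> {y}) \<union> (B \<times> (U \<times> (Y - W)) \<union> (B \<times> ((U - X) \<times> W) \<union> B \<times> (X \<times> (W - {y})))))"
    by (intro tileable_Un 1 2 3 4) (use C W in \<open>auto simp: X_def\<close>)
  moreover have "B \<times> (C \<times> {y}) \<union> (B \<times> (U \<times> (Y - W)) \<union> (B \<times> ((U - X) \<times> W) \<union> B \<times> (X \<times> (W - {y}))))
      = B \<times> (U \<times> Y \<union> {(v, y)})"
    using C W unfolding X_def by blast
  ultimately show ?thesis by simp
qed

lemma mod_add_right_inj: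
  fixes x y r m :: nat
  assumes "x < m" "y < m" "(x + r) mod m = (y + r) mod m"
  shows "x = y"
proof -
  have *: "x = y" if "x \<le> y" "x < m" "y < m" "(x + r) mod m = (y + r) mod m" for x y
  proof -
    have "m dvd (y + r) - (x + r)" using that by (metis add_le_mono1 mod_eq_dvd_iff_nat)
    then have "m dvd y - x" by simp
    then show ?thesis using that by (metis diff_is_0_eq dvd_imp_le le_antisym less_imp_diff_less not_le zero_less_iff_neq_zero)
  qed
  show ?thesis using *[of x y] *[of y x] assms by (cases "x \<le> y") auto
qed

text \<open>A point all of whose coordinates lie in \<open>V\<close> is absorbed along the coordinate given by the sum of its
  coordinates (numbered by \<open>e\<close>) modulo \<open>m\<close>. Since \<open>m > card V\<close>, every line absorbs at most one such point.\<close>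

lemma ex_tileable_power:
  assumes V: "finite V" "V \<subseteq> Y"
    and base: "tileable (prod_tiles FB FY) (B \<times> (Y - V))"
    and pt: "\<And>v. v \<in> V \<Longrightarrow> tileable (prod_tiles FB FY) (B \<times> ((Y - V) \<union> {v}))"
  shows "\<exists>m. tileable (prod_tiles FB (pow_tiles FY m)) (B \<times> power_set Y m)"
proof -
  obtain e where e: "bij_betw e V {..<card V}"
    using ex_bij_betw_finite_nat[OF V(1)] by (metis atLeast0LessThan)
  \<comment> \<open>All values of \<open>e\<close> are below \<open>m\<close>, and \<open>m\<close>
    is positive even if \<open>V\<close> is empty.\<close>
  define m where "m = Suc (card V)"
  have em: "e v < m" if "v \<in> V" for v using bij_betwE[OF e] that unfolding m_def by auto
  \<comment> \<open>A point with some coordinate outside \<open>V\<close> is assigned to the first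
    such coordinate, so that it is never among the points needing absorption on its line.\<close>
  define \<alpha> where "\<alpha> f = (if \<exists>i<m. f i \<notin> V then LEAST i. i < m \<and> f i \<notin> V
    else (\<Sum>j<m. e (f j)) mod m)" for f
  have \<alpha>_less: "\<alpha> f < m" for f
  proof (cases "\<exists>i<m. f i \<notin> V")
    case True
    then show ?thesis unfolding \<alpha>_def using LeastI_ex[of "\<lambda>i. i < m \<and> f i \<notin> V"] by simp
  next
    case False
    then show ?thesis unfolding \<alpha>_def by (simp only: if_False) (simp add: m_def)
  qed
  have \<alpha>_notin: "f (\<alpha> f) \<notin> V" if "\<exists>i<m. f i \<notin> V" for f
    using that unfolding \<alpha>_def using LeastI_ex[of "\<lambda>i. i < m \<and> f i \<notin> V"] by simp
  \<comment> \<open>The part of the line through \<open>g\<close> in direction \<open>i\<close> that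
    is assigned to this direction. It turns out to be empty, \<open>Y - V\<close>, or
    \<open>Y - V\<close> with one point of \<open>V\<close> added.\<close>
  define M where "M i g = {b \<in> Y. \<alpha> (g(i := b)) = i}" for i and g :: "nat \<Rightarrow> 'a"
  have M: "tileable (prod_tiles FB FY) (B \<times> M i g)" if i: "i < m" for i g
  proof (cases "\<exists>j<m. j \<noteq> i \<and> g j \<notin> V")
    \<comment> \<open>Another coordinate already lies outside \<open>V\<close>. Moving
      \<open>b\<close> within \<open>Y - V\<close> does not change the first coordinate outside
      \<open>V\<close>, so it is all or nothing.\<close>
    case True
    then have ex: "\<exists>l<m. (g(i := b)) l \<notin> V" for b by auto
    have sub: "M i g \<subseteq> Y - V"
      unfolding M_def using \<alpha>_notin[OF ex] by (auto, metis fun_upd_same)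
    have eq: "\<alpha> (g(i := b)) = \<alpha> (g(i := b'))" if "b \<notin> V" "b' \<notin> V" for b b'
    proof -
      have "(\<lambda>l. l < m \<and> (g(i := b)) l \<notin> V) = (\<lambda>l. l < m \<and> (g(i := b')) l \<notin> V)"
        using that by auto
      then show ?thesis unfolding \<alpha>_def using ex by presburger
    qed
    have "M i g = Y - V" if "M i g \<noteq> {}"
    proof -
      obtain b where b: "b \<in> M i g" using \<open>M i g \<noteq> {}\<close> by blast
      have "b' \<in> M i g" if "b' \<in> Y - V" for b'
        using b sub eq[of b b'] that unfolding M_def by auto
      then show ?thesis using sub by blast
    qed
    then show ?thesis using base tileable_empty by (cases "M i g = {}") auto
  next
    case False
    \<comment> \<open>All other coordinates lie in \<open>V\<close>. Every \<open>b\<close> outside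
      \<open>V\<close> is then assigned to \<open>i\<close>, while for \<open>b\<close> in
      \<open>V\<close> the sum modulo \<open>m\<close> equals \<open>i\<close> at most once, as
      \<open>e\<close> is injective with values below \<open>m\<close>.\<close>
    define r where "r = (\<Sum>j\<in>{..<m} - {i}. e (g j))"
    have inV: "\<alpha> (g(i := b)) = (e b + r) mod m" if "b \<in> V" for b
    proof -
      have "\<not> (\<exists>l<m. (g(i := b)) l \<notin> V)" using that False by auto
      then have "\<alpha> (g(i := b)) = (\<Sum>j<m. e ((g(i := b)) j)) mod m"
        unfolding \<alpha>_def by (simp only: if_False)
      also have "(\<Sum>j<m. e ((g(i := b)) j)) = e b + r"
        unfolding r_def using i by (subst sum.remove[of _ i]) (auto intro!: sum.cong)
      finally show ?thesis .
    qed
    have notV: "\<alpha> (g(i := b)) = i" if "b \<notin> V" for b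
    proof -
      have "\<exists>l<m. (g(i := b)) l \<notin> V" using that i by auto
      then have "(g(i := b)) (\<alpha> (g(i := b))) \<notin> V" by (rule \<alpha>_notin)
      then show ?thesis using False \<alpha>_less[of "g(i := b)"] by (metis fun_upd_other)
    qed
    have uniq: "b = b'" if "b \<in> V" "b' \<in> V" "(e b + r) mod m = i" "(e b' + r) mod m = i" for b b'
    proof -
      have "e b = e b'" by (rule mod_add_right_inj[of _ m _ r]) (use that em in auto)
      then show ?thesis using bij_betw_imp_inj_on[OF e] that by (auto simp: inj_on_def)
    qed
    have M_eq: "M i g = (Y - V) \<union> {b \<in> V. (e b + r) mod m = i}"
      unfolding M_def using inV notV V(2) by auto
    show ?thesis
    proof (cases "\<exists>v\<in>V. (e v + r) mod m = i")
      case True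
      then obtain v where v: "v \<in> V" "(e v + r) mod m = i" by blast
      then have "{b \<in> V. (e b + r) mod m = i} = {v}" using uniq by blast
      then show ?thesis using M_eq pt[OF v(1)] by simp
    next
      case False
      then have "M i g = Y - V" using M_eq by blast
      then show ?thesis using base by simp
    qed
  qed
  \<comment> \<open>The coordinate \<open>i\<close> of \<open>g\<close> is \<open>undefined\<close>,
    so each point \<open>f\<close> determines its pair: \<open>i = \<alpha> f\<close> and
    \<open>g = f(i := undefined)\<close>.\<close>
  define K where "K = (SIGMA i:{..<m}. PiE ({..<m} - {i}) (\<lambda>_. Y))"
  define X where "X p = (case p of (i, g) \<Rightarrow> (\<lambda>(\<omega>, b). (\<omega>, g(i := b))) ` (B \<times> M i g))"
    for p :: "nat \<times> (nat \<Rightarrow> 'a)"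
  have "tileable (prod_tiles FB (pow_tiles FY m)) (\<Union>p\<in>K. X p)"
  proof (rule tileable_UN)
    fix p assume "p \<in> K"
    then obtain i g where p: "p = (i, g)" "i < m" unfolding K_def by auto
    have "tileable (prod_tiles FB (pow_tiles FY m)) ((\<lambda>(\<omega>, b). (\<omega>, g(i := b))) ` (B \<times> M i g))"
    proof (rule tileable_image[OF M[OF p(2)]])
      show "inj_on (\<lambda>(\<omega>, b). (\<omega>, g(i := b))) (B \<times> M i g)"
        by (auto simp: inj_on_def dest: fun_upd_eqD)
      fix D assume "D \<in> prod_tiles FB FY"
      then consider A w where "A \<in> FB" "D = A \<times> {w}" | \<omega> A where "A \<in> FY" "D = {\<omega>} \<times> A"
        unfolding prod_tiles_def by blast
      then show "tileable (prod_tiles FB (pow_tiles FY m)) ((\<lambda>(\<omega>, b). (\<omega>, g(i := b))) ` D)"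
      proof cases
        case 1
        have "(\<lambda>(\<omega>, b). (\<omega>, g(i := b))) ` D = A \<times> {g(i := w)}" unfolding 1 by auto
        then show ?thesis using tileable_Times[OF tileable_tile[OF 1(1)]] by metis
      next
        case 2
        have "(\<lambda>(\<omega>, b). (\<omega>, g(i := b))) ` D = {\<omega>} \<times> ((\<lambda>b. g(i := b)) ` A)" unfolding 2 by auto
        moreover have "(\<lambda>b. g(i := b)) ` A \<in> pow_tiles FY m"
          unfolding pow_tiles_def using p(2) 2(1) by blast
        ultimately show ?thesis by (metis tileable_Sigma tileable_tile)
      qed
    qed
    then show "tileable (prod_tiles FB (pow_tiles FY m)) (X p)" unfolding X_def p by simp
  next
    fix p p' assume pp: "p \<in> K" "p' \<in> K" "p \<noteq> p'"
    have key: "\<alpha> f = i \<and> g = f(i := undefined)"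
      if iK: "(i, g) \<in> K" and fX: "(\<omega>, f) \<in> X (i, g)" for i g \<omega> f
    proof -
      obtain b where b: "f = g(i := b)" "b \<in> M i g" using fX unfolding X_def by auto
      have "g i = undefined" using iK unfolding K_def by (auto simp: PiE_def extensional_def)
      then show ?thesis using b unfolding M_def by auto
    qed
    show "X p \<inter> X p' = {}"
    proof (rule ccontr)
      assume "X p \<inter> X p' \<noteq> {}"
      then obtain \<omega> f where f: "(\<omega>, f) \<in> X p" "(\<omega>, f) \<in> X p'" by auto
      obtain i g i' g' where "p = (i, g)" "p' = (i', g')" by (metis surj_pair)
      then show False using key[of i g \<omega> f] key[of i' g' \<omega> f] pp f by auto
    qed
  qed
  moreover have "(\<Union>p\<in>K. X p) = B \<times> power_set Y m"
  proof (intro equalityI subsetI)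
    fix z assume "z \<in> (\<Union>p\<in>K. X p)"
    then obtain i g \<omega> b where z: "z = (\<omega>, g(i := b))" "\<omega> \<in> B" "b \<in> Y" "i < m"
      "g \<in> PiE ({..<m} - {i}) (\<lambda>_. Y)"
      unfolding K_def X_def M_def by auto
    then have "g(i := b) \<in> power_set Y m"
      by (auto simp: PiE_def extensional_def Pi_def)
    then show "z \<in> B \<times> power_set Y m" using z by simp
  next
    fix z assume "z \<in> B \<times> power_set Y m"
    then obtain \<omega> f where z: "z = (\<omega>, f)" "\<omega> \<in> B" "f \<in> power_set Y m" by auto
    define i where "i = \<alpha> f"
    have i: "i < m" unfolding i_def by (rule \<alpha>_less)
    have "(i, f(i := undefined)) \<in> K"
      using z(3) i unfolding K_def by (auto simp: PiE_def extensional_def Pi_def)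
    moreover have "z \<in> X (i, f(i := undefined))"
    proof -
      have "f i \<in> M i (f(i := undefined))" using z(3) i unfolding M_def by (auto simp: i_def)
      then show ?thesis unfolding X_def z(1) using z(2) by (auto intro!: image_eqI[of _ _ "(\<omega>, f i)"])
    qed
    ultimately show "z \<in> (\<Union>p\<in>K. X p)" by blast
  qed
  ultimately show ?thesis by metis
qed

section \<open>Coverings of constant multiplicity on the square of a finite set\<close>

lemma sum_list_threshold:
  fixes b c k :: nat
  assumes "c \<le> b"
  shows "(\<Sum>j\<leftarrow>[0..<b]. if c + j < b then k else 0) = k * (b - c)"
proof -
  have "(\<Sum>j\<leftarrow>[0..<b]. if c + j < b then k else 0) = (\<Sum>j\<in>{0..<b}. if c + j < b then k else 0)"
    by (simp add: interv_sum_list_conv_sum_set_nat)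
  also have "\<dots> = (\<Sum>j\<in>{0..<b - c}. k)"
    by (rule sum.mono_neutral_cong_right) auto
  finally show ?thesis by simp
qed

lemma length_filter_Times:
  "length (filter (\<lambda>D. (x, y) \<in> D) (map (\<lambda>C. Q \<times> C) Bs))
    = (if x \<in> Q then length (filter (\<lambda>C. y \<in> C) Bs) else 0)"
  by (simp add: filter_map o_def)

lemma length_filter_concat:
  "length (filter P (concat (map g xs))) = (\<Sum>x\<leftarrow>xs. length (filter P (g x)))"
  by (simp add: filter_concat length_concat o_def)

text \<open>The excess \<open>k * c x\<close> of the first covering is evened out in the second factor, by using copies of the
  \<open>k\<close>-fold covering over the points \<open>x\<close> where \<open>c x\<close> is small.\<close>

lemma ex_coverings:
  fixes F :: "'a set set" and \<Omega> :: "'a set"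
  assumes \<Omega>: "finite \<Omega>" "\<Omega> \<noteq> {}"
    and As: "\<And>A. A \<in> set As \<Longrightarrow> A \<in> F \<and> A \<subseteq> \<Omega>"
    and Bs: "\<And>A. A \<in> set Bs \<Longrightarrow> A \<in> F \<and> A \<subseteq> \<Omega>"
    and covA: "\<And>x. x \<in> \<Omega> \<Longrightarrow> length (filter (\<lambda>A. x \<in> A) As) = Suc (k * c x)"
    and covB: "\<And>x. x \<in> \<Omega> \<Longrightarrow> length (filter (\<lambda>A. x \<in> A) Bs) = k"
  obtains L1 L2 e q where
    "\<And>C. C \<in> set L1 \<Longrightarrow> tileable (prod_tiles F F) C \<and> C \<subseteq> \<Omega> \<times> \<Omega>"
    "\<And>C. C \<in> set L2 \<Longrightarrow> tileable (prod_tiles F F) C \<and> C \<subseteq> \<Omega> \<times> \<Omega>"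
    "\<And>\<omega>. \<omega> \<in> \<Omega> \<times> \<Omega> \<Longrightarrow> length (filter (\<lambda>C. \<omega> \<in> C) L1) = Suc e"
    "\<And>\<omega>. \<omega> \<in> \<Omega> \<times> \<Omega> \<Longrightarrow> length (filter (\<lambda>C. \<omega> \<in> C) L2) = e"
    "length L1 = Suc e + q" "length L2 = e + q"
proof -
  define b where "b = Max (c ` \<Omega>)"
  have cb: "c x \<le> b" if "x \<in> \<Omega>" for x unfolding b_def using \<Omega> that by simp
  \<comment> \<open>Over \<open>x\<close> exactly \<open>b - c x\<close> of the indices
    \<open>j\<close> are active, which raises the multiplicity from \<open>1 + k * c x\<close> to
    \<open>1 + k * b\<close>.\<close>
  define L1 where "L1 = map (\<lambda>A. A \<times> \<Omega>) As
    @ concat (map (\<lambda>j. map (\<lambda>C. {x \<in> \<Omega>. c x + j < b} \<times> C) Bs) [0..<b])"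
  \<comment> \<open>The empty members make \<open>L2\<close> exactly one shorter than
    \<open>L1\<close>. Since the multiplicities also differ by one, the number \<open>q\<close> of
    open sheets agrees.\<close>
  define L2 where "L2 = replicate (length As - 1) {}
    @ concat (map (\<lambda>j. map (\<lambda>C. \<Omega> \<times> C) Bs) [0..<b])"
  obtain x0 where x0: "x0 \<in> \<Omega>" using \<Omega>(2) by blast
  have "length (filter (\<lambda>A. x0 \<in> A) As) \<le> length As" by simp
  then have lenA: "length As \<ge> 1" using covA[OF x0] by simp
  have cov1: "length (filter (\<lambda>C. (x, y) \<in> C) L1) = Suc (k * b)" if "x \<in> \<Omega>" "y \<in> \<Omega>" for x y
  proof -
    have "length (filter (\<lambda>C. (x, y) \<in> C) (map (\<lambda>A. A \<times> \<Omega>) As)) = Suc (k * c x)"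
      using that covA by (simp add: filter_map o_def)
    moreover have "length (filter (\<lambda>C. (x, y) \<in> C)
        (concat (map (\<lambda>j. map (\<lambda>C. {x \<in> \<Omega>. c x + j < b} \<times> C) Bs) [0..<b]))) = k * (b - c x)"
    proof -
      have "(\<Sum>j\<leftarrow>[0..<b]. if x \<in> {x \<in> \<Omega>. c x + j < b} then k else 0) = k * (b - c x)"
        using sum_list_threshold[OF cb[OF that(1)], of k] that by simp
      then show ?thesis
        unfolding length_filter_concat length_filter_Times covB[OF that(2)] .
    qed
    ultimately have "length (filter (\<lambda>C. (x, y) \<in> C) L1) = Suc (k * c x) + k * (b - c x)"
      unfolding L1_def filter_append length_append by presburger
    also have "\<dots> = Suc (k * b)"
      using cb[OF that(1)] by (metis add_Suc distrib_left le_add_diff_inverse)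
    finally show ?thesis .
  qed
  have cov2: "length (filter (\<lambda>C. (x, y) \<in> C) L2) = k * b" if "x \<in> \<Omega>" "y \<in> \<Omega>" for x y
    unfolding L2_def filter_append length_append length_filter_concat length_filter_Times
      covB[OF that(2)] using that by (simp add: sum_list_triv)
  have l2: "length L2 = (length As - 1) + b * length Bs"
    unfolding L2_def by (simp add: length_concat o_def sum_list_triv)
  have l1: "length L1 = length As + b * length Bs"
    unfolding L1_def by (simp add: length_concat o_def sum_list_triv)
  have "k * b \<le> length L2" using cov2[OF x0 x0] by (metis length_filter_le)
  then obtain q where q: "length L2 = k * b + q" using le_Suc_ex by blast
  have q1: "length L1 = Suc (k * b) + q" using q l1 l2 lenA by simp
  have s1: "tileable (prod_tiles F F) C \<and> C \<subseteq> \<Omega> \<times> \<Omega>" if C: "C \<in> set L1" for C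
  proof -
    consider A where "A \<in> set As" "C = A \<times> \<Omega>"
      | Q A where "A \<in> set Bs" "C = Q \<times> A" "Q \<subseteq> \<Omega>"
      using C unfolding L1_def by auto
    then show ?thesis
    proof cases
      case 1
      then have "tileable (prod_tiles F F) (A \<times> \<Omega>)"
        using As by (intro tileable_Times tileable_tile) blast
      then show ?thesis using 1 As by blast
    next
      case 2
      then have "tileable (prod_tiles F F) (Q \<times> A)"
        using Bs by (intro tileable_Sigma tileable_tile) auto
      then show ?thesis using 2 Bs by blast
    qed
  qed
  have s2: "tileable (prod_tiles F F) C \<and> C \<subseteq> \<Omega> \<times> \<Omega>" if C: "C \<in> set L2" for C
  proof (cases "C = {}")
    case True then show ?thesis by (simp add: tileable_empty)
  next
    case False
    then obtain A where A: "A \<in> set Bs" "C = \<Omega> \<times> A" using C unfolding L2_def by (auto split: if_splits)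
    then have "tileable (prod_tiles F F) (\<Omega> \<times> A)"
      using Bs by (intro tileable_Sigma tileable_tile) auto
    then show ?thesis using A Bs by blast
  qed
  show thesis
    by (rule that[of L1 L2 "k * b" q]) (use s1 s2 cov1 cov2 q q1 in auto)
qed

text \<open>The set to be absorbed is \<open>V = (H - U) \<times> Y\<close> with \<open>Y\<close> a
  power of \<open>\<Omega>\<close>; its complement is tiled through \<open>U\<close>. A point
  \<open>(v, y)\<close> of \<open>V\<close> is absorbed by the tile from \<open>HU\<close> together
  with the gadget at \<open>y\<close>.\<close>

lemma ex_tileable_product:
  fixes F :: "'a set set" and \<Omega> :: "'a set" and FH :: "'b set set" and H :: "'b set"
  assumes \<Omega>: "finite \<Omega>" "\<Omega> \<noteq> {}"
    and As: "\<And>A. A \<in> set As \<Longrightarrow> A \<in> F \<and> A \<subseteq> \<Omega>"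
    and Bs: "\<And>A. A \<in> set Bs \<Longrightarrow> A \<in> F \<and> A \<subseteq> \<Omega>"
    and covA: "\<And>x. x \<in> \<Omega> \<Longrightarrow> length (filter (\<lambda>A. x \<in> A) As) = Suc (k * c x)"
    and covB: "\<And>x. x \<in> \<Omega> \<Longrightarrow> length (filter (\<lambda>A. x \<in> A) Bs) = k" and k: "k > 0"
    and H: "finite H" and U: "U \<subseteq> H" "tileable FH U"
    and HU: "\<And>v. v \<in> H - U \<Longrightarrow> \<exists>C\<in>FH. v \<in> C \<and> C - {v} \<subseteq> U"
  shows "\<exists>d m. tileable
    (prod_tiles (prod_tiles F F) (pow_tiles (prod_tiles FH (pow_tiles F d)) m))
    ((\<Omega> \<times> \<Omega>) \<times> power_set (H \<times> power_set \<Omega> d) m)"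
proof (rule ex_coverings[OF \<Omega> As Bs covA covB])
  fix L1 L2 e q assume L:
    "\<And>C. C \<in> set L1 \<Longrightarrow> tileable (prod_tiles F F) C \<and> C \<subseteq> \<Omega> \<times> \<Omega>"
    "\<And>C. C \<in> set L2 \<Longrightarrow> tileable (prod_tiles F F) C \<and> C \<subseteq> \<Omega> \<times> \<Omega>"
    "\<And>\<omega>. \<omega> \<in> \<Omega> \<times> \<Omega> \<Longrightarrow> length (filter (\<lambda>C. \<omega> \<in> C) L1) = Suc e"
    "\<And>\<omega>. \<omega> \<in> \<Omega> \<times> \<Omega> \<Longrightarrow> length (filter (\<lambda>C. \<omega> \<in> C) L2) = e"
    "length L1 = Suc e + q" "length L2 = e + q"
  have F: "\<exists>C\<in>F. x \<in> C \<and> C \<subseteq> \<Omega>" if "x \<in> \<Omega>" for x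
  proof -
    have "filter (\<lambda>A. x \<in> A) Bs \<noteq> []" using covB[OF that] k by auto
    then obtain A where "A \<in> set Bs" "x \<in> A" by (auto simp: filter_empty_conv)
    then show ?thesis using Bs by blast
  qed
  define d where "d = 2 * (Suc e + q) + q"
  define Y where "Y = power_set \<Omega> d"
  define V where "V = (H - U) \<times> Y"
  let ?FB = "prod_tiles F F" and ?FY = "prod_tiles FH (pow_tiles F d)"
  have finV: "finite V" unfolding V_def Y_def using \<Omega>(1) H by (auto intro!: finite_PiE)
  have HV: "H \<times> Y - V = U \<times> Y" unfolding V_def using U by blast
  have "\<exists>m. tileable (prod_tiles ?FB (pow_tiles ?FY m)) ((\<Omega> \<times> \<Omega>) \<times> power_set (H \<times> Y) m)"
  proof (rule ex_tileable_power[of V])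
    show "finite V" by (rule finV)
    show "V \<subseteq> H \<times> Y" unfolding V_def by blast
    show "tileable (prod_tiles ?FB ?FY) ((\<Omega> \<times> \<Omega>) \<times> (H \<times> Y - V))"
      unfolding HV by (rule tileable_Sigma, rule tileable_Times, rule U(2))
    fix v' assume "v' \<in> V"
    then obtain v y where v: "v' = (v, y)" "v \<in> H - U" "y \<in> Y" unfolding V_def by auto
    obtain C where C: "C \<in> FH" "v \<in> C" "C - {v} \<subseteq> U" using HU[OF v(2)] by blast
    obtain W where W: "W \<subseteq> Y" "y \<in> W"
      "tileable (prod_tiles ?FB (pow_tiles F d)) ((\<Omega> \<times> \<Omega>) \<times> W)"
      "tileable (prod_tiles ?FB (pow_tiles F d)) ((\<Omega> \<times> \<Omega>) \<times> (W - {y}))"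
      using ex_gadget[OF L F d_def v(3)[unfolded Y_def]] unfolding Y_def by blast
    show "tileable (prod_tiles ?FB ?FY) ((\<Omega> \<times> \<Omega>) \<times> (H \<times> Y - V \<union> {v'}))"
      unfolding HV v(1) by (rule tileable_absorb_point[OF U(2) C _ W]) (use v in blast)
  qed
  then show ?thesis unfolding Y_def by blast
qed

section \<open>Pulling back tilings to the integer lattice\<close>

definition axis_tiles :: "int set \<Rightarrow> nat \<Rightarrow> (nat \<Rightarrow> int) set set" where
  "axis_tiles A J = {(\<lambda>a. x(j := x j + a)) ` A | x j. j < J \<and> x \<in> zspace J}"

text \<open>Tilings of \<open>\<Omega>\<close> are pulled back along \<open>\<pi>\<close>. The
  condition concerns single tiles only, which lets it pass to products and powers.\<close>

definition realizable :: "int set \<Rightarrow> 'a set \<Rightarrow> 'a set set \<Rightarrow> bool" where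
  "realizable A \<Omega> F \<longleftrightarrow> (\<exists>J \<pi>. (\<forall>z\<in>zspace J. \<pi> z \<in> \<Omega>)
    \<and> (\<forall>B\<in>F. tileable (axis_tiles A J) {z \<in> zspace J. \<pi> z \<in> B}))"

lemma zspace_upd: "z \<in> zspace J \<Longrightarrow> j < J \<Longrightarrow> z(j := c) \<in> zspace J"
  unfolding zspace_def by auto

lemma tileable_vimage:
  assumes "tileable F X" "\<And>B. B \<in> F \<Longrightarrow> tileable G {z \<in> Z. \<pi> z \<in> B}"
  shows "tileable G {z \<in> Z. \<pi> z \<in> X}"
proof -
  obtain P where P: "P \<subseteq> F" "disjoint P" "\<Union>P = X"
    using assms(1) unfolding tileable_def by blast
  have "tileable G (\<Union>B\<in>P. {z \<in> Z. \<pi> z \<in> B})"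
  proof (rule tileable_UN)
    fix B assume "B \<in> P"
    then show "tileable G {z \<in> Z. \<pi> z \<in> B}" using assms(2) P(1) by blast
  next
    fix B C assume "B \<in> P" "C \<in> P" "B \<noteq> C"
    then have "B \<inter> C = {}" using P(2) by (auto simp: disjoint_def)
    then show "{z \<in> Z. \<pi> z \<in> B} \<inter> {z \<in> Z. \<pi> z \<in> C} = {}" by blast
  qed
  moreover have "(\<Union>B\<in>P. {z \<in> Z. \<pi> z \<in> B}) = {z \<in> Z. \<pi> z \<in> X}" using P(3) by blast
  ultimately show ?thesis by simp
qed

lemma realizable_tileable:
  assumes "realizable A \<Omega> F" "tileable F \<Omega>"
  shows "\<exists>J. tileable (axis_tiles A J) (zspace J)"
proof -
  obtain J \<pi> where \<pi>: "\<forall>z\<in>zspace J. \<pi> z \<in> \<Omega>"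
    "\<And>B. B \<in> F \<Longrightarrow> tileable (axis_tiles A J) {z \<in> zspace J. \<pi> z \<in> B}"
    using assms(1) unfolding realizable_def by blast
  have "{z \<in> zspace J. \<pi> z \<in> \<Omega>} = zspace J" using \<pi>(1) by blast
  then show ?thesis using tileable_vimage[OF assms(2) \<pi>(2)] by metis
qed

section \<open>Blocks of coordinates, products and powers\<close>

definition pull :: "(nat \<Rightarrow> nat) \<Rightarrow> nat \<Rightarrow> (nat \<Rightarrow> int) \<Rightarrow> nat \<Rightarrow> int" where
  "pull e J z = (\<lambda>i. if i < J then z (e i) else 0)"

lemma pull_zspace: "pull e J z \<in> zspace J"
  unfolding pull_def zspace_def by auto

text \<open>\<open>R\<close> constrains only the coordinates outside the block selected by
  \<open>e\<close>. Once these are fixed, the remaining ones run through a slice that is a copy of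
  \<open>zspace J'\<close>, and the tiling of \<open>X\<close> is repeated in every slice allowed by
  \<open>R\<close>.\<close>

lemma tileable_pull:
  assumes e: "inj_on e {..<J'}" "e ` {..<J'} \<subseteq> {..<J}"
    and X: "tileable (axis_tiles A J') X" "X \<subseteq> zspace J'"
    and R: "\<And>z z'. (\<And>i. i \<notin> e ` {..<J'} \<Longrightarrow> z i = z' i) \<Longrightarrow> R z \<Longrightarrow> R z'"
  shows "tileable (axis_tiles A J) {z \<in> zspace J. pull e J' z \<in> X \<and> R z}"
proof -
  define push where "push r x = (\<lambda>i. if i \<in> e ` {..<J'} then x (inv_into {..<J'} e i) else r i)"
    for r x :: "nat \<Rightarrow> int"
  have push_e: "push r x (e i) = x i" if "i < J'" for r x i
    unfolding push_def using inv_into_f_f[OF e(1)] that by simp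
  have push_other: "push r x i = r i" if "i \<notin> e ` {..<J'}" for r x i
    unfolding push_def using that by simp
  have pull_push: "pull e J' (push r x) = x" if "x \<in> zspace J'" for r x
    using that push_e unfolding pull_def zspace_def by auto
  have push_zspace: "push r x \<in> zspace J" if "r \<in> zspace J" for r x
  proof -
    have "push r x i = 0" if "i \<ge> J" for i
    proof -
      have "i \<notin> e ` {..<J'}" using e(2) that by auto
      then show ?thesis using push_other[of i r x] \<open>r \<in> zspace J\<close> that by (simp add: zspace_def)
    qed
    then show ?thesis by (simp add: zspace_def)
  qed
  \<comment> \<open>Zeros inside the block choose one representative \<open>r\<close> for each
    slice.\<close>
  define Rs where "Rs = {r \<in> zspace J. (\<forall>i\<in>e ` {..<J'}. r i = 0) \<and> R r}"
  have R_push: "R (push r x)" if "R r" for r x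
    by (rule R[OF _ that]) (simp add: push_other)
  have "tileable (axis_tiles A J) (\<Union>r\<in>Rs. push r ` X)"
  proof (rule tileable_UN)
    fix r assume r: "r \<in> Rs"
    show "tileable (axis_tiles A J) (push r ` X)"
    proof (rule tileable_image[OF X(1)])
      show "inj_on (push r) X"
        by (rule inj_on_inverseI[of _ "pull e J'"]) (use X(2) pull_push in auto)
      fix B assume "B \<in> axis_tiles A J'"
      then obtain x j where B: "B = (\<lambda>a. x(j := x j + a)) ` A" "j < J'" "x \<in> zspace J'"
        unfolding axis_tiles_def by blast
      have "push r (x(j := x j + a)) = (push r x)(e j := push r x (e j) + a)" for a
      proof
        fix i
        show "push r (x(j := x j + a)) i = ((push r x)(e j := push r x (e j) + a)) i"
        proof (cases "i \<in> e ` {..<J'}")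
          case True
          then obtain l where l: "i = e l" "l < J'" by auto
          have "e l = e j \<longleftrightarrow> l = j" using e(1) l B(2) by (auto simp: inj_on_def)
          then show ?thesis using l B(2) push_e by auto
        next
          case False
          then show ?thesis using B(2) push_other by auto
        qed
      qed
      then have "push r ` B = (\<lambda>a. (push r x)(e j := push r x (e j) + a)) ` A"
        unfolding B(1) image_image by simp
      moreover have "push r x \<in> zspace J" using push_zspace r unfolding Rs_def by blast
      moreover have "e j < J" using e(2) B(2) by blast
      ultimately have "push r ` B \<in> axis_tiles A J" unfolding axis_tiles_def by blast
      then show "tileable (axis_tiles A J) (push r ` B)" by (rule tileable_tile)
    qed
  next
    fix r s assume rs: "r \<in> Rs" "s \<in> Rs" "r \<noteq> s"
    have "push r x \<noteq> push s x'" for x x'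
    proof
      assume eq: "push r x = push s x'"
      have "r i = s i" for i
        using rs(1,2) fun_cong[OF eq, of i] push_other[of i] unfolding Rs_def
        by (cases "i \<in> e ` {..<J'}") auto
      then show False using rs(3) by blast
    qed
    then show "push r ` X \<inter> push s ` X = {}" by blast
  qed
  moreover have "(\<Union>r\<in>Rs. push r ` X) = {z \<in> zspace J. pull e J' z \<in> X \<and> R z}"
  proof (intro equalityI subsetI)
    fix z assume "z \<in> (\<Union>r\<in>Rs. push r ` X)"
    then obtain r x where rx: "r \<in> Rs" "x \<in> X" "z = push r x" by blast
    then show "z \<in> {z \<in> zspace J. pull e J' z \<in> X \<and> R z}"
      using push_zspace R_push pull_push X(2) unfolding Rs_def by auto
  next
    fix z assume z: "z \<in> {z \<in> zspace J. pull e J' z \<in> X \<and> R z}"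
    define r where "r = (\<lambda>i. if i \<in> e ` {..<J'} then 0 else z i)"
    have "R r" by (rule R[of z]) (use z in \<open>auto simp: r_def\<close>)
    moreover have "r \<in> zspace J" using z unfolding r_def zspace_def by auto
    ultimately have "r \<in> Rs" unfolding Rs_def r_def by simp
    moreover have "z = push r (pull e J' z)"
    proof
      fix i
      show "z i = push r (pull e J' z) i"
        by (cases "i \<in> e ` {..<J'}") (auto simp: push_e push_other pull_def r_def)
    qed
    ultimately show "z \<in> (\<Union>r\<in>Rs. push r ` X)" using z by blast
  qed
  ultimately show ?thesis by simp
qed

text \<open>The coordinates of the two realizations are juxtaposed. For a tile in one factor, the
  fixed value in the other becomes the side condition \<open>R\<close> of
  \<open>tileable_pull\<close>.\<close>

lemma realizable_prod:
  assumes "realizable A \<Omega>1 F1" "realizable A \<Omega>2 F2"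
  shows "realizable A (\<Omega>1 \<times> \<Omega>2) (prod_tiles F1 F2)"
proof -
  obtain J1 \<pi>1 where 1: "\<forall>z\<in>zspace J1. \<pi>1 z \<in> \<Omega>1"
    "\<And>B. B \<in> F1 \<Longrightarrow> tileable (axis_tiles A J1) {z \<in> zspace J1. \<pi>1 z \<in> B}"
    using assms(1) unfolding realizable_def by blast
  obtain J2 \<pi>2 where 2: "\<forall>z\<in>zspace J2. \<pi>2 z \<in> \<Omega>2"
    "\<And>B. B \<in> F2 \<Longrightarrow> tileable (axis_tiles A J2) {z \<in> zspace J2. \<pi>2 z \<in> B}"
    using assms(2) unfolding realizable_def by blast
  define lo where "lo = pull (\<lambda>i. i) J1"
  define hi where "hi = pull (\<lambda>i. J1 + i) J2"
  define \<pi> where "\<pi> z = (\<pi>1 (lo z), \<pi>2 (hi z))" for z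
  have lo: "lo z \<in> zspace J1" and hi: "hi z \<in> zspace J2" for z
    unfolding lo_def hi_def by (rule pull_zspace)+
  have "tileable (axis_tiles A (J1 + J2)) {z \<in> zspace (J1 + J2). \<pi> z \<in> D}"
    if "D \<in> prod_tiles F1 F2" for D
  proof -
    consider B y where "B \<in> F1" "D = B \<times> {y}" | x C where "C \<in> F2" "D = {x} \<times> C"
      using \<open>D \<in> prod_tiles F1 F2\<close> unfolding prod_tiles_def by blast
    then show ?thesis
    proof cases
      case 1
      have "tileable (axis_tiles A (J1 + J2)) {z \<in> zspace (J1 + J2).
          pull (\<lambda>i. i) J1 z \<in> {z \<in> zspace J1. \<pi>1 z \<in> B} \<and> \<pi>2 (hi z) = y}"
      proof (rule tileable_pull)
        fix z z' :: "nat \<Rightarrow> int"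
        assume "\<And>i. i \<notin> (\<lambda>i. i) ` {..<J1} \<Longrightarrow> z i = z' i"
        then have "hi z = hi z'" unfolding hi_def pull_def by auto
        then show "\<pi>2 (hi z) = y \<Longrightarrow> \<pi>2 (hi z') = y" by simp
      qed (use \<open>B \<in> F1\<close> \<open>\<And>B. B \<in> F1 \<Longrightarrow> _ B\<close> in auto)
      moreover have "{z \<in> zspace (J1 + J2).
          pull (\<lambda>i. i) J1 z \<in> {z \<in> zspace J1. \<pi>1 z \<in> B} \<and> \<pi>2 (hi z) = y}
        = {z \<in> zspace (J1 + J2). \<pi> z \<in> D}"
        using lo unfolding \<pi>_def lo_def 1 by auto
      ultimately show ?thesis by simp
    next
      case 2
      have "tileable (axis_tiles A (J1 + J2)) {z \<in> zspace (J1 + J2).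
          pull (\<lambda>i. J1 + i) J2 z \<in> {z \<in> zspace J2. \<pi>2 z \<in> C} \<and> \<pi>1 (lo z) = x}"
      proof (rule tileable_pull)
        fix z z' :: "nat \<Rightarrow> int"
        assume zz: "\<And>i. i \<notin> (\<lambda>i. J1 + i) ` {..<J2} \<Longrightarrow> z i = z' i"
        have "z i = z' i" if "i < J1" for i by (rule zz) (use that in auto)
        then have "lo z = lo z'" unfolding lo_def pull_def by auto
        then show "\<pi>1 (lo z) = x \<Longrightarrow> \<pi>1 (lo z') = x" by simp
      qed (use \<open>C \<in> F2\<close> \<open>\<And>B. B \<in> F2 \<Longrightarrow> _ B\<close> in auto)
      moreover have "{z \<in> zspace (J1 + J2).
          pull (\<lambda>i. J1 + i) J2 z \<in> {z \<in> zspace J2. \<pi>2 z \<in> C} \<and> \<pi>1 (lo z) = x}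
        = {z \<in> zspace (J1 + J2). \<pi> z \<in> D}"
        using hi unfolding \<pi>_def hi_def 2 by auto
      ultimately show ?thesis by simp
    qed
  qed
  moreover have "\<pi> z \<in> \<Omega>1 \<times> \<Omega>2" for z unfolding \<pi>_def using 1(1) 2(1) lo hi by blast
  ultimately show ?thesis unfolding realizable_def by blast
qed

lemma realizable_pow:
  assumes "realizable A \<Omega> F"
  shows "realizable A (power_set \<Omega> m) (pow_tiles F m)"
proof -
  obtain J \<pi> where \<pi>: "\<forall>z\<in>zspace J. \<pi> z \<in> \<Omega>"
    "\<And>B. B \<in> F \<Longrightarrow> tileable (axis_tiles A J) {z \<in> zspace J. \<pi> z \<in> B}"
    using assms unfolding realizable_def by blast
  define blk where "blk i = pull (\<lambda>l. i * J + l) J" for i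
  define \<rho> where "\<rho> z = (\<lambda>i. if i < m then \<pi> (blk i z) else undefined)" for z
  have blk: "blk i z \<in> zspace J" for i z unfolding blk_def by (rule pull_zspace)
  have sep: "i = i'" if "i * J + l = i' * J + l'" "l < J" "l' < J" for i i' l l'
  proof -
    have "(i * J + l) div J = i" "(i' * J + l') div J = i'" using that(2,3) by auto
    then show ?thesis using that(1) by simp
  qed
  have "tileable (axis_tiles A (m * J)) {z \<in> zspace (m * J). \<rho> z \<in> D}"
    if D0: "D \<in> pow_tiles F m" for D
  proof -
    obtain f i B where D: "D = (\<lambda>b. f(i := b)) ` B" "i < m" "B \<in> F"
      using D0 unfolding pow_tiles_def by blast
    have "tileable (axis_tiles A (m * J)) {z \<in> zspace (m * J).
        pull (\<lambda>l. i * J + l) J z \<in> {z \<in> zspace J. \<pi> z \<in> B} \<and> (\<forall>i'. i' \<noteq> i \<longrightarrow> \<rho> z i' = f i')}"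
    proof (rule tileable_pull)
      show "inj_on (\<lambda>l. i * J + l) {..<J}" by (auto simp: inj_on_def)
      have "i * J + l < m * J" if "l < J" for l
      proof -
        have "i * J + l < Suc i * J" using that by simp
        also have "\<dots> \<le> m * J" using D(2) by (intro mult_le_mono1) simp
        finally show ?thesis .
      qed
      then show "(\<lambda>l. i * J + l) ` {..<J} \<subseteq> {..<m * J}" by auto
      fix z z' :: "nat \<Rightarrow> int"
      assume zz: "\<And>l. l \<notin> (\<lambda>l. i * J + l) ` {..<J} \<Longrightarrow> z l = z' l"
        and z: "\<forall>i'. i' \<noteq> i \<longrightarrow> \<rho> z i' = f i'"
      have "blk i' z = blk i' z'" if "i' \<noteq> i" for i'
      proof -
        have "z (i' * J + l) = z' (i' * J + l)" if "l < J" for l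
          by (rule zz) (use sep that \<open>i' \<noteq> i\<close> in blast)
        then show ?thesis unfolding blk_def pull_def by auto
      qed
      then show "\<forall>i'. i' \<noteq> i \<longrightarrow> \<rho> z' i' = f i'" using z unfolding \<rho>_def by auto
    qed (use \<pi>(2)[OF D(3)] in auto)
    moreover have "{z \<in> zspace (m * J).
        pull (\<lambda>l. i * J + l) J z \<in> {z \<in> zspace J. \<pi> z \<in> B} \<and> (\<forall>i'. i' \<noteq> i \<longrightarrow> \<rho> z i' = f i')}
      = {z \<in> zspace (m * J). \<rho> z \<in> D}"
    proof -
      have "\<rho> z \<in> D \<longleftrightarrow> \<rho> z i \<in> B \<and> (\<forall>i'. i' \<noteq> i \<longrightarrow> \<rho> z i' = f i')" for z
      proof
        assume "\<rho> z i \<in> B \<and> (\<forall>i'. i' \<noteq> i \<longrightarrow> \<rho> z i' = f i')"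
        moreover from this have "\<rho> z = f(i := \<rho> z i)" by auto
        ultimately show "\<rho> z \<in> D" unfolding D(1) by blast
      qed (auto simp: D(1))
      moreover have "\<rho> z i = \<pi> (blk i z)" for z using D(2) unfolding \<rho>_def by simp
      ultimately show ?thesis using blk unfolding blk_def by auto
    qed
    ultimately show ?thesis by simp
  qed
  moreover have "\<rho> z \<in> power_set \<Omega> m" for z
    unfolding \<rho>_def using \<pi>(1) blk by (auto split: if_splits)
  ultimately show ?thesis unfolding realizable_def by blast
qed

text \<open>The preimage of a tile consists of the translates of \<open>A\<close> along axis
  \<open>j\<close> that start at the points \<open>z\<close> with \<open>\<pi> z = x\<close>: the
  point of parameter \<open>a\<close> maps to \<open>\<tau> a\<close>. Injectivity of
  \<open>\<tau>\<close> lets each point recover \<open>a\<close>, hence its starting point, so the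
  translates are disjoint.\<close>

lemma realizableI:
  assumes \<Omega>: "\<And>z. z \<in> zspace J \<Longrightarrow> \<pi> z \<in> \<Omega>"
    and F: "\<And>B. B \<in> F \<Longrightarrow> \<exists>j<J. \<exists>\<tau> x. B = \<tau> ` A \<and> inj_on \<tau> A
      \<and> (\<forall>z\<in>zspace J. \<forall>a\<in>A. \<pi> z = \<tau> a \<longleftrightarrow> \<pi> (z(j := z j - a)) = x)"
  shows "realizable A \<Omega> F"
proof -
  have "tileable (axis_tiles A J) {z \<in> zspace J. \<pi> z \<in> B}" if "B \<in> F" for B
  proof -
    obtain j \<tau> x where j: "j < J" and B: "B = \<tau> ` A" and inj: "inj_on \<tau> A"
      and shift: "\<And>z a. z \<in> zspace J \<Longrightarrow> a \<in> A \<Longrightarrow> \<pi> z = \<tau> a \<longleftrightarrow> \<pi> (z(j := z j - a)) = x"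
      using F[OF \<open>B \<in> F\<close>] by blast
    define Z where "Z = {z \<in> zspace J. \<pi> z = x}"
    have up: "\<pi> (z(j := z j + a)) = \<tau> a" if "z \<in> Z" "a \<in> A" for z a
      using shift[of "z(j := z j + a)" a] zspace_upd[OF _ j] that unfolding Z_def by simp
    have "tileable (axis_tiles A J) (\<Union>z\<in>Z. (\<lambda>a. z(j := z j + a)) ` A)"
    proof (rule tileable_UN)
      fix z assume "z \<in> Z"
      then show "tileable (axis_tiles A J) ((\<lambda>a. z(j := z j + a)) ` A)"
        using j unfolding Z_def axis_tiles_def by (intro tileable_tile) blast
    next
      fix z z' assume z: "z \<in> Z" "z' \<in> Z" "z \<noteq> z'"
      have "z(j := z j + a) \<noteq> z'(j := z' j + a')" if a: "a \<in> A" "a' \<in> A" for a a'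
      proof
        assume eq: "z(j := z j + a) = z'(j := z' j + a')"
        then have "\<tau> a = \<tau> a'" using up[OF z(1) a(1)] up[OF z(2) a(2)] by simp
        then have "a = a'" using inj a by (auto simp: inj_on_def)
        then have "z i = z' i" for i using fun_cong[OF eq, of i] by (cases "i = j") auto
        then show False using z(3) by blast
      qed
      then show "(\<lambda>a. z(j := z j + a)) ` A \<inter> (\<lambda>a. z'(j := z' j + a)) ` A = {}" by blast
    qed
    moreover have "(\<Union>z\<in>Z. (\<lambda>a. z(j := z j + a)) ` A) = {z \<in> zspace J. \<pi> z \<in> B}"
    proof (intro equalityI subsetI)
      fix w assume "w \<in> (\<Union>z\<in>Z. (\<lambda>a. z(j := z j + a)) ` A)"
      then obtain z a where "z \<in> Z" "a \<in> A" "w = z(j := z j + a)" by blast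
      then show "w \<in> {z \<in> zspace J. \<pi> z \<in> B}"
        using up zspace_upd[OF _ j] unfolding B Z_def by auto
    next
      fix w assume w: "w \<in> {z \<in> zspace J. \<pi> z \<in> B}"
      then obtain a where a: "a \<in> A" "\<pi> w = \<tau> a" unfolding B by blast
      define z where "z = w(j := w j - a)"
      have "z \<in> Z" unfolding Z_def z_def using shift[of w a] a w zspace_upd[OF _ j] by blast
      moreover have "w = z(j := z j + a)" unfolding z_def by simp
      ultimately show "w \<in> (\<Union>z\<in>Z. (\<lambda>a. z(j := z j + a)) ` A)" using a(1) by blast
    qed
    ultimately show ?thesis by simp
  qed
  then show ?thesis unfolding realizable_def using \<Omega> by blast
qed

section \<open>Coverings of a cyclic group\<close>

text \<open>Solves \<open>(\<Sum>d\<in>A. weight (n - d)) \<equiv> 1\<close> modulo \<open>k\<close> recursively, using \<open>0 \<in> A\<close>.\<close>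

fun weight :: "nat set \<Rightarrow> nat \<Rightarrow> nat \<Rightarrow> nat" where
  "weight A k n = nat ((1 - (\<Sum>d\<in>A \<inter> {1..n}. int (weight A k (n - d)))) mod int k)"

declare weight.simps [simp del]

lemma weight_less: "k > 0 \<Longrightarrow> weight A k n < k"
  by (subst weight.simps) (simp add: nat_less_iff)

lemma weight_rec:
  assumes "A \<subseteq> {..D}" "D \<le> n"
  shows "weight A k n = nat ((1 - (\<Sum>d\<in>A - {0}. int (weight A k (n - d)))) mod int k)"
proof -
  have "A \<inter> {1..n} = A - {0}" using assms by auto
  then show ?thesis by (subst weight.simps) simp
qed

lemma sum_weight:
  assumes "A \<subseteq> {..D}" "0 \<in> A" "D \<le> n" "k > 0"
  shows "(\<Sum>d\<in>A. weight A k (n - d)) mod k = 1 mod k"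
proof -
  have fin: "finite A" using assms(1) finite_subset by blast
  let ?s = "\<Sum>d\<in>A - {0}. int (weight A k (n - d))"
  have "int (weight A k n) = (1 - ?s) mod int k"
    using weight_rec[OF assms(1,3), of k] assms(4) by simp
  then have "(int (weight A k n) + ?s) mod int k = 1 mod int k"
    by (simp add: mod_add_left_eq)
  moreover have "int (\<Sum>d\<in>A. weight A k (n - d)) = int (weight A k n) + ?s"
    using sum.remove[OF fin assms(2), of "\<lambda>d. weight A k (n - d)"] by simp
  ultimately have "int (\<Sum>d\<in>A. weight A k (n - d)) mod int k = 1 mod int k" by simp
  then show ?thesis by (metis of_nat_1 of_nat_eq_iff zmod_int)
qed

text \<open>Pigeonhole: there are finitely many windows of \<open>D\<close> consecutive values below
  \<open>k\<close>, so two equal windows occur, and by \<open>weight_rec\<close> they continue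
  identically.\<close>

lemma weight_periodic:
  assumes A: "A \<subseteq> {..D}" and k: "k > 0"
  obtains n0 p where "p > 0" "\<And>n. n \<ge> n0 \<Longrightarrow> weight A k (n + p) = weight A k n"
proof -
  define win where "win n = map (\<lambda>i. weight A k (n + i)) [0..<D]" for n
  have "range win \<subseteq> {xs. set xs \<subseteq> {..<k} \<and> length xs = D}"
    using weight_less[OF k] unfolding win_def by auto
  then have "finite (range win)"
    using finite_lists_length_eq[of "{..<k}" D] finite_subset by blast
  then have "\<not> inj win" using finite_imageD infinite_UNIV_nat by blast
  then obtain m n where mn: "win m = win n" "m \<noteq> n" unfolding inj_def by blast
  define n1 n2 where "n1 = min m n" and "n2 = max m n"
  have n12: "n1 < n2" "win n1 = win n2" using mn unfolding n1_def n2_def by (auto simp: min_def max_def)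
  define p where "p = n2 - n1"
  have start: "weight A k (n1 + i + p) = weight A k (n1 + i)" if "i < D" for i
  proof -
    have "win n1 ! i = win n2 ! i" using n12 by simp
    then show ?thesis using that n12(1) unfolding win_def p_def by (simp add: add.commute)
  qed
  have "weight A k (n1 + i + p) = weight A k (n1 + i)" for i
  proof (induction i rule: less_induct)
    case (less i)
    show ?case
    proof (cases "i < D")
      case True then show ?thesis by (rule start)
    next
      case False
      have "weight A k (n1 + i + p - d) = weight A k (n1 + i - d)" if "d \<in> A - {0}" for d
      proof -
        have d: "d \<le> D" "d > 0" using that A by auto
        then have "n1 + i + p - d = n1 + (i - d) + p" "n1 + i - d = n1 + (i - d)" "i - d < i"
          using False by auto
        then show ?thesis using less.IH[of "i - d"] by simp
      qed
      then have "(\<Sum>d\<in>A - {0}. int (weight A k (n1 + i + p - d)))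
          = (\<Sum>d\<in>A - {0}. int (weight A k (n1 + i - d)))" by simp
      then show ?thesis
        using weight_rec[OF A, of "n1 + i + p" k] weight_rec[OF A, of "n1 + i" k] False by simp
    qed
  qed
  then have "weight A k (n + p) = weight A k n" if "n \<ge> n1" for n
    using that by (metis le_add_diff_inverse)
  moreover have "p > 0" using n12 unfolding p_def by simp
  ultimately show thesis using that by blast
qed

lemma periodic_add_mult:
  fixes w :: "nat \<Rightarrow> 'a"
  assumes "\<And>n. n \<ge> n0 \<Longrightarrow> w (n + p) = w n" "n \<ge> n0"
  shows "w (n + p * t) = w n"
proof (induction t)
  case (Suc t)
  have "w (n + p * t + p) = w (n + p * t)" by (rule assms(1)) (use assms(2) in simp)
  then show ?case using Suc by (simp add: algebra_simps)
qed simp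

lemma ex_cyclic_weight:
  fixes A :: "int set" and D k :: nat
  assumes A: "A \<subseteq> {0..int D}" "0 \<in> A" and k: "k > 0"
  shows "\<exists>N>D. \<exists>w. \<forall>x. (\<Sum>a\<in>A. w ((x - a) mod int N)) mod k = 1 mod k \<and> (\<Sum>a\<in>A. w ((x - a) mod int N)) > 0"
proof -
  define A0 where "A0 = nat ` A"
  have A0: "A0 \<subseteq> {..D}" "0 \<in> A0" using A unfolding A0_def by force+
  have inj: "inj_on nat A" by (rule inj_on_inverseI[of _ int]) (use A(1) in auto)
  have finA: "finite A" using A(1) finite_subset by blast
  obtain n0 p where p: "p > 0" "\<And>n. n \<ge> n0 \<Longrightarrow> weight A0 k (n + p) = weight A0 k n"
    using weight_periodic[OF A0(1) k] by blast
  \<comment> \<open>The weights are read from the periodic range beyond \<open>n0\<close>. Adding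
    \<open>k\<close> preserves residues and makes all sums positive.\<close>
  define w where "w x = k + weight A0 k (n0 + nat (x mod int p))" for x
  \<comment> \<open>A multiple of the period, so that reduction modulo \<open>N\<close> does not
    affect \<open>w\<close>, and larger than \<open>D\<close>, so that \<open>A\<close> stays
    injective modulo \<open>N\<close>.\<close>
  define N where "N = p * Suc D"
  have "D < N" unfolding N_def using p(1) by (cases p) auto
  moreover have "(\<Sum>a\<in>A. w ((x - a) mod int N)) mod k = 1 mod k" for x
  proof -
    \<comment> \<open>A representative of \<open>x\<close> shifted so far that every
      \<open>m - d\<close> with \<open>d \<le> D\<close> is still in the periodic range and
      \<open>sum_weight\<close> applies at \<open>m\<close>.\<close>
    define m where "m = n0 + nat (x mod int p) + p * D"
    have mD: "m \<ge> D" "m - d \<ge> n0" if "d \<le> D" for d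
    proof -
      have "p * D \<ge> D" using p(1) by simp
      then show "m \<ge> D" "m - d \<ge> n0" unfolding m_def using that by linarith+
    qed
    have "w ((x - a) mod int N) = k + weight A0 k (m - nat a)" if "a \<in> A" for a
    proof -
      have "a \<in> {0..int D}" using that A(1) by blast
      then have a: "0 \<le> a" "nat a \<le> D" by auto
      have wN: "w ((x - a) mod int N) = w (x - a)"
        unfolding w_def N_def by (simp add: mod_mod_cancel)
      define j where "j = nat ((x - a) mod int p)"
      define i where "i = m - nat a - n0"
      have m: "m - nat a = n0 + i" using mD(2)[OF a(2)] unfolding i_def by simp
      have "i + nat a = nat (x mod int p) + p * D"
        using m a(2) mD(1)[OF a(2)] unfolding m_def by linarith
      then have "int (i + nat a) = int (nat (x mod int p) + p * D)" by (rule arg_cong)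
      then have "int i = x mod int p + int p * int D - a" using a(1) p(1) by simp
      then have "int i mod int p = (x mod int p + int p * int D - a) mod int p" by simp
      also have "\<dots> = (x - a) mod int p"
        by (metis mod_diff_left_eq mod_mod_trivial mod_mult_self2)
      finally have ij: "i mod p = j" unfolding j_def by (metis nat_int zmod_int)
      have "weight A0 k (n0 + i) = weight A0 k (n0 + i mod p + p * (i div p))"
        by (simp add: add.assoc)
      also have "\<dots> = weight A0 k (n0 + i mod p)"
        by (rule periodic_add_mult[of n0 "weight A0 k" p, OF p(2)]) auto
      finally have "weight A0 k (m - nat a) = weight A0 k (n0 + j)" using m ij by simp
      then show ?thesis unfolding wN by (simp add: w_def j_def)
    qed
    then have "(\<Sum>a\<in>A. w ((x - a) mod int N)) = (\<Sum>a\<in>A. k + weight A0 k (m - nat a))" by simp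
    also have "\<dots> = card A * k + (\<Sum>a\<in>A. weight A0 k (m - nat a))" by (simp add: sum.distrib)
    also have "(\<Sum>a\<in>A. weight A0 k (m - nat a)) = (\<Sum>d\<in>A0. weight A0 k (m - d))"
      unfolding A0_def using sum.reindex[OF inj, of "\<lambda>d. weight (nat ` A) k (m - d)"] by simp
    finally show ?thesis using sum_weight[OF A0 mD(1)[of 0] k] by simp
  qed
  moreover have "(\<Sum>a\<in>A. w ((x - a) mod int N)) > 0" for x
  proof -
    have "w ((x - 0) mod int N) \<le> (\<Sum>a\<in>A. w ((x - a) mod int N))"
      by (rule member_le_sum[of 0]) (use A finA in auto)
    then show ?thesis using k unfolding w_def by simp
  qed
  ultimately show ?thesis by blast
qed

definition cyclic_tile :: "int set \<Rightarrow> nat \<Rightarrow> int \<Rightarrow> int set" where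
  "cyclic_tile A N u = (\<lambda>a. (a + u) mod int N) ` A"

lemma int_eq_if_mod_eq:
  fixes a b :: int
  assumes "a mod int N = b mod int N" "\<bar>a - b\<bar> < int N"
  shows "a = b"
proof (rule ccontr)
  assume "a \<noteq> b"
  moreover have "int N dvd a - b" using assms(1) by (simp add: mod_eq_dvd_iff)
  ultimately have "\<bar>int N\<bar> \<le> \<bar>a - b\<bar>" by (intro dvd_imp_le_int) auto
  then show False using assms(2) by simp
qed

text \<open>The translate by \<open>u\<close> contains \<open>x\<close> exactly when
  \<open>u\<close> is \<open>x - a\<close> modulo \<open>N\<close> for some \<open>a\<close> in
  \<open>A\<close>, and these residues are distinct because \<open>D < N\<close>.\<close>

lemma cyclic_covering:
  assumes A: "A \<subseteq> {0..int D}" and N: "D < N" and x: "x \<in> {0..<int N}"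
  shows "length (filter (\<lambda>B. x \<in> B) (concat (map (\<lambda>u. replicate (w u) (cyclic_tile A N u)) [0..int N - 1])))
    = (\<Sum>a\<in>A. w ((x - a) mod int N))"
proof -
  have inj: "inj_on (\<lambda>a. (x - a) mod int N) A"
  proof (rule inj_onI)
    fix a b assume ab: "a \<in> A" "b \<in> A" "(x - a) mod int N = (x - b) mod int N"
    have "a \<in> {0..int D}" "b \<in> {0..int D}" using ab A by blast+
    then have "x - a = x - b" using N by (intro int_eq_if_mod_eq[OF ab(3)]) auto
    then show "a = b" by simp
  qed
  have mem: "u \<in> {0..int N - 1} \<and> x \<in> cyclic_tile A N u \<longleftrightarrow> u \<in> (\<lambda>a. (x - a) mod int N) ` A" for u
  proof
    assume "u \<in> {0..int N - 1} \<and> x \<in> cyclic_tile A N u"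
    then obtain a where a: "a \<in> A" "x = (a + u) mod int N" "0 \<le> u" "u < int N"
      unfolding cyclic_tile_def by auto
    then have "(x - a) mod int N = u" by (simp add: mod_diff_left_eq)
    then show "u \<in> (\<lambda>a. (x - a) mod int N) ` A" using a by blast
  next
    assume "u \<in> (\<lambda>a. (x - a) mod int N) ` A"
    then obtain a where a: "a \<in> A" "u = (x - a) mod int N" by blast
    then have "x = (a + u) mod int N" using x by (simp add: mod_add_right_eq)
    then show "u \<in> {0..int N - 1} \<and> x \<in> cyclic_tile A N u"
      using a N unfolding cyclic_tile_def by auto
  qed
  have "length (filter (\<lambda>B. x \<in> B) (concat (map (\<lambda>u. replicate (w u) (cyclic_tile A N u)) [0..int N - 1])))
      = (\<Sum>u\<leftarrow>[0..int N - 1]. if x \<in> cyclic_tile A N u then w u else 0)"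
    by (simp add: filter_concat length_concat o_def filter_replicate if_distrib cong: if_cong)
  also have "\<dots> = (\<Sum>u\<in>{0..int N - 1}. if x \<in> cyclic_tile A N u then w u else 0)"
    by (simp add: interv_sum_list_conv_sum_set_int)
  also have "\<dots> = (\<Sum>u\<in>(\<lambda>a. (x - a) mod int N) ` A. w u)"
    by (rule sum.mono_neutral_cong_right) (use mem in \<open>auto simp del: atLeastAtMost_iff\<close>)
  also have "\<dots> = (\<Sum>a\<in>A. w ((x - a) mod int N))" using sum.reindex[OF inj] by simp
  finally show ?thesis .
qed

lemma realizable_cyclic:
  assumes A: "A \<subseteq> {0..int D}" and N: "D < N"
  shows "realizable A {0..<int N} (range (cyclic_tile A N))"
proof (rule realizableI[of 1 "\<lambda>z. z 0 mod int N"])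
  fix z :: "nat \<Rightarrow> int"
  show "z 0 mod int N \<in> {0..<int N}" using N by simp
next
  fix B assume "B \<in> range (cyclic_tile A N)"
  then obtain u where B: "B = (\<lambda>a. (a + u) mod int N) ` A" unfolding cyclic_tile_def by blast
  have "inj_on (\<lambda>a. (a + u) mod int N) A"
  proof (rule inj_onI)
    fix a b assume ab: "a \<in> A" "b \<in> A" "(a + u) mod int N = (b + u) mod int N"
    have "a \<in> {0..int D}" "b \<in> {0..int D}" using ab A by blast+
    then have "a + u = b + u" using N by (intro int_eq_if_mod_eq[OF ab(3)]) auto
    then show "a = b" by simp
  qed
  moreover have "z 0 mod int N = (a + u) mod int N \<longleftrightarrow> (z(0 := z 0 - a)) 0 mod int N = u mod int N"
    for z :: "nat \<Rightarrow> int" and a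
    by (simp add: mod_eq_dvd_iff algebra_simps)
  ultimately show "\<exists>j<1. \<exists>\<tau> x. B = \<tau> ` A \<and> inj_on \<tau> A \<and>
      (\<forall>z\<in>zspace 1. \<forall>a\<in>A. (z 0 mod int N = \<tau> a) = ((z(j := z j - a)) 0 mod int N = x))"
    using B by (intro exI[of _ 0] conjI exI[of _ "\<lambda>a. (a + u) mod int N"] exI[of _ "u mod int N"]) auto
qed

section \<open>Affine tiles in a vector group\<close>

text \<open>Images of \<open>A\<close> under affine maps into the vectors modulo \<open>M\<close>; the coordinates are indexed by \<open>A\<close> itself,
  so that the point of the tile with parameter \<open>a\<close> can be prescribed in coordinate \<open>a\<close>.\<close>

definition lin_tile :: "int set \<Rightarrow> int \<Rightarrow> (int \<Rightarrow> int) \<Rightarrow> (int \<Rightarrow> int) \<Rightarrow> (int \<Rightarrow> int) set" where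
  "lin_tile A M y h = (\<lambda>a. restrict (\<lambda>j. (y j + a * h j) mod M) A) ` A"

definition lin_tiles :: "int set \<Rightarrow> int \<Rightarrow> (int \<Rightarrow> int) set set" where
  "lin_tiles A M = {lin_tile A M y h | y h. h \<in> PiE A (\<lambda>_. {0..<M}) \<and> (\<exists>j\<in>A. h j \<noteq> 0)}"

text \<open>For the modulus \<open>1 + fact D\<close> all differences of elements of \<open>A\<close> are invertible.\<close>

lemma coprime_Suc_fact:
  fixes a :: int
  assumes "a \<noteq> 0" "\<bar>a\<bar> \<le> int D"
  shows "coprime a (1 + fact D)"
proof (rule coprimeI)
  fix c assume c: "c dvd a" "c dvd 1 + fact D"
  have "nat \<bar>a\<bar> dvd (fact D :: nat)" using assms by (intro dvd_fact) auto
  then have "int (nat \<bar>a\<bar>) dvd int (fact D)" by (simp only: int_dvd_int_iff)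
  then have "a dvd fact D" by simp
  then have "c dvd fact D" using c(1) dvd_trans by blast
  then show "is_unit c" using c(2) by (simp add: dvd_add_left_iff)
qed

lemma restrict_mod_eq_iff:
  fixes f g :: "int \<Rightarrow> int"
  shows "restrict (\<lambda>j. f j mod M) A = restrict (\<lambda>j. g j mod M) A \<longleftrightarrow> (\<forall>j\<in>A. M dvd f j - g j)"
  by (auto simp: fun_eq_iff restrict_def mod_eq_dvd_iff)

text \<open>At a coordinate with \<open>h j \<noteq> 0\<close>, a coincidence of the points of
  parameters \<open>a\<close> and \<open>b\<close> makes the modulus divide
  \<open>(a - b) * h j\<close>. The difference is invertible, so the modulus divides
  \<open>h j\<close>, which lies strictly between 0 and the modulus.\<close>

lemma inj_on_lin_tile:
  assumes A: "A \<subseteq> {0..int D}" and h: "h \<in> PiE A (\<lambda>_. {0..<1 + fact D})" "\<exists>j\<in>A. h j \<noteq> 0"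
  shows "inj_on (\<lambda>a. restrict (\<lambda>j. (y j + a * h j) mod (1 + fact D)) A) A"
proof (rule inj_onI, rule ccontr)
  fix a b assume ab: "a \<in> A" "b \<in> A" "a \<noteq> b"
    and eq: "restrict (\<lambda>j. (y j + a * h j) mod (1 + fact D)) A
      = restrict (\<lambda>j. (y j + b * h j) mod (1 + fact D)) A"
  obtain j where j: "j \<in> A" "h j \<noteq> 0" using h(2) by blast
  have hj: "0 < h j" "h j < 1 + fact D" using PiE_mem[OF h(1) j(1)] j(2) by auto
  have "1 + fact D dvd (y j + a * h j) - (y j + b * h j)"
    using eq j(1) unfolding restrict_mod_eq_iff by blast
  then have "1 + fact D dvd (a - b) * h j" by (simp add: algebra_simps)
  moreover have "coprime (a - b) (1 + fact D)"
  proof (rule coprime_Suc_fact)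
    have "a \<in> {0..int D}" "b \<in> {0..int D}" using ab A by blast+
    then show "\<bar>a - b\<bar> \<le> int D" by auto
  qed (use ab in simp)
  ultimately have "1 + fact D dvd h j" by (simp add: coprime_commute coprime_dvd_mult_right_iff)
  then show False using hj zdvd_not_zless by blast
qed

text \<open>There is one lattice coordinate for every nonzero direction vector, and
  \<open>\<pi>\<close> sends the unit vector of that coordinate to the direction. Moving by
  \<open>a\<close> along an axis thus adds \<open>a\<close> times its direction.\<close>

lemma realizable_lin:
  assumes A: "A \<subseteq> {0..int D}"
  shows "realizable A (PiE A (\<lambda>_. {0..<1 + fact D})) (lin_tiles A (1 + fact D))"
proof -
  let ?M = "1 + fact D :: int"
  define Dir where "Dir = {h \<in> PiE A (\<lambda>_. {0..<?M}). \<exists>j\<in>A. h j \<noteq> 0}"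
  have "finite A" using A finite_subset by blast
  then have "finite Dir" unfolding Dir_def using finite_PiE[of A "\<lambda>_. {0..<?M}"] by simp
  then obtain hs where hs: "bij_betw hs {..<card Dir} Dir"
    using ex_bij_betw_nat_finite by (metis atLeast0LessThan)
  define J where "J = card Dir"
  define \<pi> where "\<pi> z = restrict (\<lambda>j. (\<Sum>l<J. z l * hs l j) mod ?M) A" for z :: "nat \<Rightarrow> int"
  show ?thesis
  proof (rule realizableI[of J \<pi>])
    fix z :: "nat \<Rightarrow> int"
    have "0 < ?M" by (simp add: add_pos_pos)
    then show "\<pi> z \<in> PiE A (\<lambda>_. {0..<?M})" unfolding \<pi>_def by auto
  next
    fix B assume "B \<in> lin_tiles A ?M"
    then obtain y h where B: "B = lin_tile A ?M y h" and h: "h \<in> Dir"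
      unfolding lin_tiles_def Dir_def by blast
    obtain l where l: "l < J" "h = hs l" using hs h unfolding J_def bij_betw_def by auto
    have sum_upd: "(\<Sum>i<J. (z(l := z l - a)) i * hs i j) = (\<Sum>i<J. z i * hs i j) - a * h j"
      for z a j
      using l by (simp add: sum.remove[of "{..<J}" l] algebra_simps)
    have "\<pi> z = restrict (\<lambda>j. (y j + a * h j) mod ?M) A
        \<longleftrightarrow> \<pi> (z(l := z l - a)) = restrict (\<lambda>j. y j mod ?M) A" for z a
      unfolding \<pi>_def restrict_mod_eq_iff sum_upd by (simp add: algebra_simps)
    moreover have "inj_on (\<lambda>a. restrict (\<lambda>j. (y j + a * h j) mod ?M) A) A"
      using h unfolding Dir_def by (intro inj_on_lin_tile[OF A]) auto
    ultimately show "\<exists>j<J. \<exists>\<tau> x. B = \<tau> ` A \<and> inj_on \<tau> A \<and>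
        (\<forall>z\<in>zspace J. \<forall>a\<in>A. (\<pi> z = \<tau> a) = (\<pi> (z(j := z j - a)) = x))"
      using l(1) B unfolding lin_tile_def by blast
  qed
qed

text \<open>This is the tileable subset \<open>U\<close> of the group \<open>H\<close>. As
  \<open>0 \<in> A\<close> in the application, it contains every vector with a zero
  coordinate.\<close>

definition lin_core :: "int set \<Rightarrow> int \<Rightarrow> (int \<Rightarrow> int) set" where
  "lin_core A M = {y \<in> PiE A (\<lambda>_. {0..<M}). \<exists>j\<in>A. y j \<in> (\<lambda>a. a mod M) ` A}"

lemma mem_lin_core:
  assumes "y \<in> PiE A (\<lambda>_. {0..<M})" "j \<in> A" "y j = 0" "0 \<in> A"
  shows "y \<in> lin_core A M"
proof -
  have "y j \<in> (\<lambda>a. a mod M) ` A" using assms(3,4) by (intro image_eqI[of _ _ 0]) auto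
  then show ?thesis unfolding lin_core_def using assms(1,2) by blast
qed

text \<open>A vector of the core is classified by its first coordinate \<open>j\<close> with value
  in \<open>A\<close> modulo \<open>M\<close>. Letting this value vary over all of \<open>A\<close>
  modulo \<open>M\<close> stays in the class and gives a tile in the direction of a unit
  vector.\<close>

lemma tileable_lin_core:
  assumes A: "finite A" and M: "M > 1"
  shows "tileable (lin_tiles A M) (lin_core A M)"
proof -
  define A' where "A' = (\<lambda>a. a mod M) ` A"
  define X where "X j g = (\<lambda>c. g(j := c)) ` A'" for j and g :: "int \<Rightarrow> int"
  define K where "K = {(j, g). j \<in> A \<and> g \<in> PiE (A - {j}) (\<lambda>_. {0..<M}) \<and> (\<forall>i\<in>A. i < j \<longrightarrow> g i \<notin> A')}"
  have "tileable (lin_tiles A M) (\<Union>p\<in>K. X (fst p) (snd p))"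
  proof (rule tileable_UN)
    fix p assume "p \<in> K"
    then obtain j g where p: "p = (j, g)" "j \<in> A" "g \<in> PiE (A - {j}) (\<lambda>_. {0..<M})"
      unfolding K_def by auto
    define h where "h = restrict (\<lambda>i. if i = j then 1 else 0 :: int) A"
    have h: "h \<in> PiE A (\<lambda>_. {0..<M})" "h j \<noteq> 0" using M p(2) unfolding h_def by auto
    have "restrict (\<lambda>i. ((g(j := 0)) i + a * h i) mod M) A = g(j := a mod M)" for a
    proof
      fix i
      show "restrict (\<lambda>i. ((g(j := 0)) i + a * h i) mod M) A i = (g(j := a mod M)) i"
      proof (cases "i \<in> A - {j}")
        case True
        then have "g i mod M = g i" using PiE_mem[OF p(3) True] by simp
        then show ?thesis using True unfolding h_def by auto
      next
        case False
        show ?thesis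
        proof (cases "i = j")
          case True
          then show ?thesis using p(2) unfolding h_def by simp
        next
          case False
          then have "i \<notin> A" using \<open>i \<notin> A - {j}\<close> by blast
          then show ?thesis using False PiE_arb[OF p(3) \<open>i \<notin> A - {j}\<close>] by simp
        qed
      qed
    qed
    then have "X j g = lin_tile A M (g(j := 0)) h"
      unfolding X_def A'_def lin_tile_def image_image by simp
    then have "X j g \<in> lin_tiles A M" unfolding lin_tiles_def using h p(2) by blast
    then show "tileable (lin_tiles A M) (X (fst p) (snd p))" using p(1) by (simp add: tileable_tile)
  next
    fix p p' assume pp: "p \<in> K" "p' \<in> K" "p \<noteq> p'"
    have key: "j \<in> A \<and> f j \<in> A' \<and> (\<forall>i\<in>A. i < j \<longrightarrow> f i \<notin> A') \<and> g = f(j := undefined)"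
      if "(j, g) \<in> K" "f \<in> X j g" for j g f
      using that unfolding K_def X_def by (auto simp: PiE_def extensional_def)
    show "X (fst p) (snd p) \<inter> X (fst p') (snd p') = {}"
    proof (rule ccontr)
      assume "X (fst p) (snd p) \<inter> X (fst p') (snd p') \<noteq> {}"
      then obtain f where f: "f \<in> X (fst p) (snd p)" "f \<in> X (fst p') (snd p')" by blast
      have 1: "fst p \<in> A \<and> f (fst p) \<in> A' \<and> (\<forall>i\<in>A. i < fst p \<longrightarrow> f i \<notin> A') \<and> snd p = f(fst p := undefined)"
        by (rule key) (use pp f in auto)
      have 2: "fst p' \<in> A \<and> f (fst p') \<in> A' \<and> (\<forall>i\<in>A. i < fst p' \<longrightarrow> f i \<notin> A') \<and> snd p' = f(fst p' := undefined)"
        by (rule key) (use pp f in auto)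
      have "fst p = fst p'" using 1 2 by (metis linorder_neqE)
      then show False using 1 2 pp(3) by (simp add: prod_eq_iff)
    qed
  qed
  moreover have "(\<Union>p\<in>K. X (fst p) (snd p)) = lin_core A M"
  proof (intro equalityI subsetI)
    fix f assume "f \<in> (\<Union>p\<in>K. X (fst p) (snd p))"
    then obtain j g c where f: "f = g(j := c)" "c \<in> A'" "j \<in> A" "g \<in> PiE (A - {j}) (\<lambda>_. {0..<M})"
      unfolding K_def X_def by auto
    have "c \<in> {0..<M}" using f(2) M unfolding A'_def by auto
    then have "f \<in> PiE A (\<lambda>_. {0..<M})"
      using f by (auto simp: PiE_def extensional_def Pi_def)
    then show "f \<in> lin_core A M" unfolding lin_core_def A'_def[symmetric] using f by auto
  next
    fix f assume "f \<in> lin_core A M"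
    then have f: "f \<in> PiE A (\<lambda>_. {0..<M})" "\<exists>j\<in>A. f j \<in> A'"
      unfolding lin_core_def A'_def by auto
    define j where "j = Min {j \<in> A. f j \<in> A'}"
    have fin: "finite {j \<in> A. f j \<in> A'}" "{j \<in> A. f j \<in> A'} \<noteq> {}" using A f(2) by auto
    have j: "j \<in> A" "f j \<in> A'" using Min_in[OF fin] unfolding j_def by auto
    have "f i \<notin> A'" if "i \<in> A" "i < j" for i
      using Min_le[OF fin(1), of i] that unfolding j_def by fastforce
    then have "(j, f(j := undefined)) \<in> K"
      using j f(1) unfolding K_def by (auto simp: PiE_def extensional_def Pi_def)
    moreover have "f \<in> X j (f(j := undefined))"
      unfolding X_def using j(2) by (intro image_eqI[of _ _ "f j"]) auto
    ultimately show "f \<in> (\<Union>p\<in>K. X (fst p) (snd p))" by force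
  qed
  ultimately show ?thesis by simp
qed

text \<open>The direction \<open>h\<close> is chosen so that the point of parameter
  \<open>a \<noteq> 0\<close> vanishes in coordinate \<open>a\<close>: \<open>h a\<close> is
  \<open>- v a / a\<close> modulo \<open>1 + fact D\<close>, where \<open>a\<close> is invertible.
  Parameter \<open>0\<close> gives \<open>v\<close>.\<close>

lemma ex_lin_tile_into_core:
  assumes A: "A \<subseteq> {0..int D}" "0 \<in> A"
    and v: "v \<in> PiE A (\<lambda>_. {0..<1 + fact D})"
  shows "\<exists>C\<in>lin_tiles A (1 + fact D). v \<in> C \<and> C - {v} \<subseteq> lin_core A (1 + fact D)"
proof -
  let ?M = "1 + fact D :: int"
  have M: "?M > 1" by simp
  have M0: "0 < ?M" by (simp add: add_pos_pos)
  have mod_M: "x mod ?M \<in> {0..<?M}" for x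
    using pos_mod_sign[OF M0] pos_mod_bound[OF M0] by (simp only: atLeastLessThan_iff)
  have "\<exists>x\<in>{0..<?M}. (v j + j * x) mod ?M = 0" if "j \<in> A - {0}" for j
  proof -
    have "coprime j ?M" by (rule coprime_Suc_fact) (use that A in auto)
    then obtain s t where st: "s * j + t * ?M = 1" using bezout_int[of j ?M] by auto
    define x where "x = (- v j * s) mod ?M"
    have "(v j + j * x) mod ?M = (v j + j * (- v j * s)) mod ?M"
      unfolding x_def by (metis mod_add_right_eq mod_mult_right_eq)
    also have "v j + j * (- v j * s) = v j * (1 - s * j)" by (simp add: algebra_simps)
    also have "1 - s * j = t * ?M" using st by simp
    finally have "(v j + j * x) mod ?M = 0" by simp
    moreover have "x \<in> {0..<?M}" unfolding x_def by (rule mod_M)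
    ultimately show ?thesis by (rule bexI)
  qed
  then obtain s where s: "\<And>j. j \<in> A - {0} \<Longrightarrow> s j \<in> {0..<?M} \<and> (v j + j * s j) mod ?M = 0"
    by metis
  \<comment> \<open>The value \<open>1\<close> at coordinate \<open>0\<close> serves to make
    \<open>h\<close> nonzero.\<close>
  define h where "h = restrict (\<lambda>j. if j = 0 then 1 else s j) A"
  have h: "h \<in> PiE A (\<lambda>_. {0..<?M})" "h 0 \<noteq> 0" using s A(2) M unfolding h_def by auto
  let ?w = "\<lambda>a. restrict (\<lambda>j. (v j + a * h j) mod ?M) A"
  have w0: "?w 0 = v"
  proof
    fix j
    show "?w 0 j = v j"
    proof (cases "j \<in> A")
      case True
      then have "v j \<in> {0..<?M}" using v by blast
      then show ?thesis using True by simp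
    next
      case False
      then show ?thesis using v by (simp add: PiE_def extensional_def)
    qed
  qed
  have "?w a \<in> lin_core A ?M" if "a \<in> A" "a \<noteq> 0" for a
  proof -
    have "?w a a = 0" using s[of a] that unfolding h_def by simp
    moreover have "?w a \<in> PiE A (\<lambda>_. {0..<?M})" using mod_M by (simp add: restrict_PiE_iff)
    ultimately show ?thesis using that(1) A(2) by (intro mem_lin_core[of _ _ _ a])
  qed
  moreover have "a \<noteq> 0" if "?w a \<noteq> v" for a using that w0 by metis
  ultimately have "lin_tile A ?M v h - {v} \<subseteq> lin_core A ?M"
    unfolding lin_tile_def by blast
  moreover have "v \<in> lin_tile A ?M v h"
    unfolding lin_tile_def by (rule image_eqI[of _ _ 0]) (use w0 A(2) in auto)
  moreover have "lin_tile A ?M v h \<in> lin_tiles A ?M"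
    unfolding lin_tiles_def using h A(2) by blast
  ultimately show ?thesis by blast
qed

section \<open>From sets of integers to tiles\<close>

text \<open>Induction on \<open>n\<close>: the new coefficient \<open>K\<close> exceeds all
  differences of the old form on \<open>T\<close>, so equal values force equal last coordinates and
  then equal old values.\<close>

lemma ex_linear_separating:
  fixes T :: "(nat \<Rightarrow> int) set"
  assumes "finite T"
  shows "\<exists>c :: nat \<Rightarrow> int. \<forall>t\<in>T. \<forall>t'\<in>T.
    (\<Sum>i<n. c i * t i) = (\<Sum>i<n. c i * t' i) \<longrightarrow> (\<forall>i<n. t i = t' i)"
proof (induction n)
  case (Suc n)
  then obtain c :: "nat \<Rightarrow> int" where c: "\<And>t t'. t \<in> T \<Longrightarrow> t' \<in> T \<Longrightarrow>
    (\<Sum>i<n. c i * t i) = (\<Sum>i<n. c i * t' i) \<Longrightarrow> \<forall>i<n. t i = t' i" by blast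
  define \<phi> where "\<phi> t = (\<Sum>i<n. c i * t i)" for t :: "nat \<Rightarrow> int"
  define K where "K = 1 + (\<Sum>p\<in>T \<times> T. \<bar>\<phi> (fst p) - \<phi> (snd p)\<bar>)"
  have K: "\<bar>\<phi> t - \<phi> t'\<bar> < K" if "t \<in> T" "t' \<in> T" for t t'
  proof -
    have "\<bar>\<phi> (fst (t, t')) - \<phi> (snd (t, t'))\<bar> \<le> (\<Sum>p\<in>T \<times> T. \<bar>\<phi> (fst p) - \<phi> (snd p)\<bar>)"
      by (rule member_le_sum[of "(t, t')"]) (use that assms in auto)
    then show ?thesis unfolding K_def by simp
  qed
  define c' where "c' = c(n := K)"
  have c': "(\<Sum>i<Suc n. c' i * t i) = \<phi> t + K * t n" for t
    unfolding c'_def \<phi>_def by simp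
  have "\<forall>i<Suc n. t i = t' i"
    if t: "t \<in> T" "t' \<in> T" "(\<Sum>i<Suc n. c' i * t i) = (\<Sum>i<Suc n. c' i * t' i)" for t t'
  proof -
    have eq: "\<phi> t - \<phi> t' = K * (t' n - t n)" using t(3) unfolding c' by (simp add: algebra_simps)
    have "t' n = t n"
    proof (rule ccontr)
      assume "t' n \<noteq> t n"
      then have "\<bar>K\<bar> * 1 \<le> \<bar>K\<bar> * \<bar>t' n - t n\<bar>" by (intro mult_left_mono) auto
      moreover have "\<bar>\<phi> t - \<phi> t'\<bar> = \<bar>K\<bar> * \<bar>t' n - t n\<bar>" unfolding eq by (rule abs_mult)
      ultimately show False using K[OF t(1,2)] by linarith
    qed
    then have "\<forall>i<n. t i = t' i" using c[OF t(1,2)] eq unfolding \<phi>_def by simp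
    then show ?thesis using \<open>t' n = t n\<close> less_Suc_eq by auto
  qed
  then show ?case by blast
qed simp

section \<open>Copies of the tile over axis tiles\<close>

lemma tiles_iff_tileable: "tiles T d \<longleftrightarrow> tileable {S. is_copy d T S} (zspace d)"
  unfolding tiles_def tileable_def disjoint_def by (intro arg_cong[of _ _ Ex] ext) auto

definition block_shift :: "nat \<Rightarrow> nat \<Rightarrow> (nat \<Rightarrow> int) \<Rightarrow> (nat \<Rightarrow> int) \<Rightarrow> nat \<Rightarrow> int" where
  "block_shift n j z t = (\<lambda>i. z i + (if j * n \<le> i \<and> i < j * n + n then t (i - j * n) else 0))"

lemma block_shift_inj:
  assumes "block_shift n j z t = block_shift n j z t'" "t \<in> zspace n" "t' \<in> zspace n"
  shows "t = t'"
proof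
  fix i
  show "t i = t' i"
  proof (cases "i < n")
    case True
    then show ?thesis using fun_cong[OF assms(1), of "j * n + i"] unfolding block_shift_def by simp
  next
    case False
    then show ?thesis using assms(2,3) unfolding zspace_def by simp
  qed
qed

text \<open>Differences of shifted points live in block \<open>j\<close>, those of the original
  points in the first \<open>n\<close> coordinates; reindexing identifies the sums of
  squares.\<close>

lemma is_copy_block_shift:
  assumes T: "T \<subseteq> zspace n" and z: "z \<in> zspace (n * J)" and j: "j < J"
  shows "is_copy (n * J) T (block_shift n j z ` T)"
proof -
  have end_le: "j * n + n \<le> n * J"
    using mult_le_mono1[of "Suc j" J n] j by (simp add: mult.commute add.commute)
  have "n \<le> n * J" using j by (cases J) auto
  have "edist (n * J) (block_shift n j z t) (block_shift n j z t') = edist (n * J) t t'"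
    if "t \<in> T" "t' \<in> T" for t t'
  proof -
    have t: "t i = 0" "t' i = 0" if "i \<ge> n" for i
      using T \<open>t \<in> T\<close> \<open>t' \<in> T\<close> that unfolding zspace_def by auto
    have "(\<Sum>i<n * J. (real_of_int (block_shift n j z t i - block_shift n j z t' i))\<^sup>2)
        = (\<Sum>i\<in>{j * n..<j * n + n}. (real_of_int (t (i - j * n) - t' (i - j * n)))\<^sup>2)"
      by (rule sum.mono_neutral_cong_right) (use end_le in \<open>auto simp: block_shift_def\<close>)
    also have "\<dots> = (\<Sum>i<n. (real_of_int (t i - t' i))\<^sup>2)"
      by (rule sum.reindex_bij_witness[of _ "\<lambda>i. j * n + i" "\<lambda>i. i - j * n"]) auto
    also have "\<dots> = (\<Sum>i<n * J. (real_of_int (t i - t' i))\<^sup>2)"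
      by (rule sum.mono_neutral_left) (use \<open>n \<le> n * J\<close> t in auto)
    finally show ?thesis unfolding edist_def by simp
  qed
  moreover have "bij_betw (block_shift n j z) T (block_shift n j z ` T)"
  proof (rule inj_on_imp_bij_betw, rule inj_onI)
    fix t t' assume "t \<in> T" "t' \<in> T" "block_shift n j z t = block_shift n j z t'"
    then show "t = t'" using block_shift_inj[of n j z t t'] T by blast
  qed
  moreover have "block_shift n j z ` T \<subseteq> zspace (n * J)"
    using z end_le unfolding zspace_def block_shift_def by auto
  ultimately show ?thesis unfolding is_copy_def by blast
qed

text \<open>\<open>\<Phi>\<close> applies the linear form to each of the \<open>J\<close> blocks of
  \<open>n\<close> coordinates. Placing \<open>t\<close> in block \<open>j\<close> changes
  coordinate \<open>j\<close> of the image by the value of the form at \<open>t\<close>, so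
  preimages of axis tiles split into copies of \<open>T\<close>. These are disjoint because the form
  is injective on \<open>T\<close>.\<close>

lemma tiles_if_axis_tileable:
  fixes T :: "(nat \<Rightarrow> int) set" and c :: "nat \<Rightarrow> int" and \<mu> :: int
  assumes T: "T \<subseteq> zspace n"
    and c: "\<And>t t'. t \<in> T \<Longrightarrow> t' \<in> T \<Longrightarrow> (\<Sum>i<n. c i * t i) = (\<Sum>i<n. c i * t' i) \<Longrightarrow> \<forall>i<n. t i = t' i"
    and A: "A = (\<lambda>t. (\<Sum>i<n. c i * t i) - \<mu>) ` T"
    and tile: "tileable (axis_tiles A J) (zspace J)"
  shows "tiles T (n * J)"
proof -
  define \<phi> where "\<phi> t = (\<Sum>i<n. c i * t i)" for t :: "nat \<Rightarrow> int"
  have inj: "t = t'" if "t \<in> T" "t' \<in> T" "\<phi> t = \<phi> t'" for t t'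
  proof
    fix i
    have "t \<in> zspace n" "t' \<in> zspace n" using that(1,2) T by blast+
    then show "t i = t' i"
      using c[OF that(1,2)] that(3) unfolding \<phi>_def zspace_def by (cases "i < n") auto
  qed
  define \<Phi> where "\<Phi> z = (\<lambda>j. if j < J then \<Sum>i<n. c i * z (j * n + i) else 0)" for z :: "nat \<Rightarrow> int"
  have \<Phi>_zspace: "\<Phi> z \<in> zspace J" for z unfolding \<Phi>_def zspace_def by simp
  have \<Phi>_shift: "\<Phi> (block_shift n j z t) = (\<Phi> z)(j := \<Phi> z j + \<phi> t)" if j: "j < J" for j z t
  proof
    fix l
    have in_blk: "j * n \<le> l * n + i \<and> l * n + i < j * n + n \<longleftrightarrow> l = j" if "i < n" for i
    proof
      assume *: "j * n \<le> l * n + i \<and> l * n + i < j * n + n"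
      have "(l * n + i) div n = l" using that by simp
      moreover have "(l * n + i) div n = j"
        using * by (intro div_nat_eqI) (auto simp: mult.commute)
      ultimately show "l = j" by simp
    qed (use that in auto)
    show "\<Phi> (block_shift n j z t) l = ((\<Phi> z)(j := \<Phi> z j + \<phi> t)) l"
    proof (cases "l = j")
      case True
      have "(\<Sum>i<n. c i * block_shift n j z t (j * n + i)) = (\<Sum>i<n. c i * z (j * n + i) + c i * t i)"
        by (rule sum.cong) (auto simp: block_shift_def distrib_left)
      then show ?thesis using True j unfolding \<Phi>_def \<phi>_def by (simp add: sum.distrib)
    next
      case False
      have "(\<Sum>i<n. c i * block_shift n j z t (l * n + i)) = (\<Sum>i<n. c i * z (l * n + i))"
        by (rule sum.cong) (use in_blk False in \<open>auto simp: block_shift_def\<close>)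
      then show ?thesis using False unfolding \<Phi>_def by simp
    qed
  qed
  let ?d = "n * J"
  have "tileable {S. is_copy ?d T S} {z \<in> zspace ?d. \<Phi> z \<in> B}" if B0: "B \<in> axis_tiles A J" for B
  proof -
    obtain x j where B: "B = (\<lambda>a. x(j := x j + a)) ` A" "j < J" "x \<in> zspace J"
      using B0 unfolding axis_tiles_def by blast
    \<comment> \<open>The elements of \<open>A\<close> are \<open>\<phi> t - \<mu>\<close>, so the
      base point absorbs \<open>\<mu>\<close>.\<close>
    have B': "B = (\<lambda>t. x(j := x j - \<mu> + \<phi> t)) ` T"
      unfolding B(1) A \<phi>_def image_image by (simp add: algebra_simps)
    define Z where "Z = {z \<in> zspace ?d. \<Phi> z = x(j := x j - \<mu>)}"
    have \<Phi>_Z: "\<Phi> (block_shift n j z t) = x(j := x j - \<mu> + \<phi> t)" if "z \<in> Z" for z t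
      using that unfolding \<Phi>_shift[OF B(2)] Z_def by simp
    have "tileable {S. is_copy ?d T S} (\<Union>z\<in>Z. block_shift n j z ` T)"
    proof (rule tileable_UN)
      fix z assume "z \<in> Z"
      then show "tileable {S. is_copy ?d T S} (block_shift n j z ` T)"
        using is_copy_block_shift[OF T _ B(2)] unfolding Z_def by (intro tileable_tile) blast
    next
      fix z z' assume z: "z \<in> Z" "z' \<in> Z" "z \<noteq> z'"
      have "block_shift n j z t \<noteq> block_shift n j z' t'" if t: "t \<in> T" "t' \<in> T" for t t'
      proof
        assume eq: "block_shift n j z t = block_shift n j z' t'"
        then have "x(j := x j - \<mu> + \<phi> t) = x(j := x j - \<mu> + \<phi> t')"
          using \<Phi>_Z[OF z(1), of t] \<Phi>_Z[OF z(2), of t'] by simp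
        then have "\<phi> t = \<phi> t'" by (metis add_left_cancel fun_upd_same)
        then have "t = t'" using inj t by blast
        then have "z i = z' i" for i 
          using fun_cong[OF eq, of i] unfolding block_shift_def by (auto split: if_splits)
        then show False using z(3) by blast
      qed
      then show "block_shift n j z ` T \<inter> block_shift n j z' ` T = {}" by blast
    qed
    moreover have "(\<Union>z\<in>Z. block_shift n j z ` T) = {z \<in> zspace ?d. \<Phi> z \<in> B}"
    proof (intro equalityI subsetI)
      fix w assume "w \<in> (\<Union>z\<in>Z. block_shift n j z ` T)"
      then obtain z t where w: "z \<in> Z" "t \<in> T" "w = block_shift n j z t" by blast
      have "block_shift n j z ` T \<subseteq> zspace ?d"
        using is_copy_block_shift[OF T _ B(2), of z] w(1) unfolding Z_def is_copy_def by blast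
      then show "w \<in> {z \<in> zspace ?d. \<Phi> z \<in> B}" using \<Phi>_Z[OF w(1)] w unfolding B' by blast
    next
      fix w assume w: "w \<in> {z \<in> zspace ?d. \<Phi> z \<in> B}"
      then obtain t where t: "t \<in> T" "\<Phi> w = x(j := x j - \<mu> + \<phi> t)" unfolding B' by blast
      define z where "z = block_shift n j w (\<lambda>i. - t i)"
      have wz: "w = block_shift n j z t" unfolding z_def block_shift_def by auto
      have "\<phi> (\<lambda>i. - t i) = - \<phi> t" unfolding \<phi>_def by (simp add: sum_negf)
      then have "\<Phi> z = x(j := x j - \<mu>)"
        unfolding z_def \<Phi>_shift[OF B(2)] t(2) by simp
      moreover have "z \<in> zspace ?d"
      proof -
        have "j * n + n \<le> n * J"
          using mult_le_mono1[of "Suc j" J n] B(2) by (simp add: mult.commute add.commute)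
        then show ?thesis using w unfolding z_def zspace_def block_shift_def by auto
      qed
      ultimately show "w \<in> (\<Union>z\<in>Z. block_shift n j z ` T)" using wz t(1) unfolding Z_def by blast
    qed
    ultimately show ?thesis by simp
  qed
  then have "tileable {S. is_copy ?d T S} {z \<in> zspace ?d. \<Phi> z \<in> zspace J}"
    by (rule tileable_vimage[OF tile])
  then show ?thesis unfolding tiles_iff_tileable using \<Phi>_zspace by simp
qed

text \<open>The coverings come from the cyclic group of order \<open>N\<close>, the absorbing factor
  \<open>H\<close> from the vectors modulo \<open>1 + fact D\<close>. Both are realizable, hence so
  is the product that is tiled.\<close>

lemma ex_axis_tiling:
  fixes A :: "int set"
  assumes A: "A \<subseteq> {0..int D}" "0 \<in> A"
  shows "\<exists>J. tileable (axis_tiles A J) (zspace J)"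
proof -
  define k where "k = card A"
  have finA: "finite A" using A(1) finite_subset by blast
  have k: "k > 0" unfolding k_def using A(2) finA card_gt_0_iff by blast
  obtain N w where N: "D < N"
    and w: "\<And>x. (\<Sum>a\<in>A. w ((x - a) mod int N)) mod k = 1 mod k"
      "\<And>x. (\<Sum>a\<in>A. w ((x - a) mod int N)) > 0"
    using ex_cyclic_weight[OF A k] by blast
  define \<Omega> where "\<Omega> = {0..<int N}"
  define F where "F = range (cyclic_tile A N)"
  define cover where "cover w = concat (map (\<lambda>u. replicate (w u) (cyclic_tile A N u)) [0..int N - 1])"
    for w :: "int \<Rightarrow> nat"
  have cover: "B \<in> F \<and> B \<subseteq> \<Omega>" if "B \<in> set (cover w)" for B w
    using that N unfolding cover_def F_def \<Omega>_def cyclic_tile_def by (auto split: if_splits)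
  define H where "H = PiE A (\<lambda>_. {0..<1 + fact D :: int})"
  define FH where "FH = lin_tiles A (1 + fact D)"
  define U where "U = lin_core A (1 + fact D)"
  \<comment> \<open>The division is exact: the sum is positive and congruent to \<open>1\<close>
    modulo \<open>k\<close>.\<close>
  define c where "c x = ((\<Sum>a\<in>A. w ((x - a) mod int N)) - 1) div k" for x
  have "\<exists>d m. tileable
    (prod_tiles (prod_tiles F F) (pow_tiles (prod_tiles FH (pow_tiles F d)) m))
    ((\<Omega> \<times> \<Omega>) \<times> power_set (H \<times> power_set \<Omega> d) m)"
  proof (rule ex_tileable_product[where As = "cover w" and Bs = "cover (\<lambda>_. 1)" and k = k and c = c and U = U])
    show "finite \<Omega>" "\<Omega> \<noteq> {}" using N unfolding \<Omega>_def by auto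
    show "B \<in> F \<and> B \<subseteq> \<Omega>" if "B \<in> set (cover w)" for B using cover that .
    show "B \<in> F \<and> B \<subseteq> \<Omega>" if "B \<in> set (cover (\<lambda>_. 1))" for B using cover that .
    show "length (filter (\<lambda>A. x \<in> A) (cover w)) = Suc (k * c x)" if "x \<in> \<Omega>" for x
    proof -
      define s where "s = (\<Sum>a\<in>A. w ((x - a) mod int N))"
      have "k dvd s - 1"
        using w(1)[of x] w(2)[of x] mod_eq_dvd_iff_nat[of 1 s k] unfolding s_def by simp
      then have "s = Suc (k * ((s - 1) div k))" using w(2)[of x] unfolding s_def[symmetric] by simp
      then show ?thesis
        using cyclic_covering[OF A(1) N, of x w] that unfolding cover_def c_def \<Omega>_def s_def by simp
    qed
    show "length (filter (\<lambda>A. x \<in> A) (cover (\<lambda>_. 1))) = k" if "x \<in> \<Omega>" for x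
      using cyclic_covering[OF A(1) N, of x "\<lambda>_. 1"] that unfolding cover_def \<Omega>_def k_def by simp
    show "k > 0" by (rule k)
    show "finite H" unfolding H_def using finA by (intro finite_PiE) auto
    show "U \<subseteq> H" unfolding U_def lin_core_def H_def by blast
    show "tileable FH U" unfolding FH_def U_def by (rule tileable_lin_core[OF finA]) simp
    show "\<exists>C\<in>FH. v \<in> C \<and> C - {v} \<subseteq> U" if "v \<in> H - U" for v
      using ex_lin_tile_into_core[OF A, of v] that unfolding FH_def U_def H_def by blast
  qed
  then obtain d m where tile: "tileable
    (prod_tiles (prod_tiles F F) (pow_tiles (prod_tiles FH (pow_tiles F d)) m))
    ((\<Omega> \<times> \<Omega>) \<times> power_set (H \<times> power_set \<Omega> d) m)" by blast
  have S: "realizable A \<Omega> F" unfolding \<Omega>_def F_def by (rule realizable_cyclic[OF A(1) N])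
  have "realizable A H FH" unfolding H_def FH_def by (rule realizable_lin[OF A(1)])
  then show ?thesis
    by (intro realizable_tileable[OF _ tile] realizable_prod realizable_pow S)
qed

theorem theorem1:
  fixes n :: nat and T :: "(nat \<Rightarrow> int) set"
  assumes "n \<ge> 1" and "is_tile n T"
  shows "\<exists>d\<ge>n. tiles T d"
proof -
  have T: "finite T" "T \<noteq> {}" "T \<subseteq> zspace n" using assms(2) unfolding is_tile_def by auto
  obtain c :: "nat \<Rightarrow> int" where c: "\<And>t t'. t \<in> T \<Longrightarrow> t' \<in> T \<Longrightarrow>
    (\<Sum>i<n. c i * t i) = (\<Sum>i<n. c i * t' i) \<Longrightarrow> \<forall>i<n. t i = t' i"
    using ex_linear_separating[OF T(1), of n] by blast
  define \<phi> where "\<phi> t = (\<Sum>i<n. c i * t i)" for t :: "nat \<Rightarrow> int"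
  \<comment> \<open>Subtracting the minimum makes \<open>A\<close> a set of nonnegative integers
    containing \<open>0\<close>, as \<open>ex_axis_tiling\<close> requires.\<close>
  define \<mu> where "\<mu> = Min (\<phi> ` T)"
  define A where "A = (\<lambda>t. \<phi> t - \<mu>) ` T"
  have fin: "finite (\<phi> ` T)" "\<phi> ` T \<noteq> {}" using T by auto
  have ge: "a \<ge> 0" if "a \<in> A" for a
    using that Min_le[OF fin(1)] unfolding A_def \<mu>_def by auto
  have finA: "finite A" unfolding A_def using T(1) by simp
  have "0 \<in> A" using Min_in[OF fin] unfolding A_def \<mu>_def by (auto simp: image_iff)
  moreover have "A \<subseteq> {0..int (nat (Max A))}"
    using ge Max_ge[OF finA] by fastforce
  ultimately obtain J where J: "tileable (axis_tiles A J) (zspace J)"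
    using ex_axis_tiling by blast
  \<comment> \<open>With \<open>J = 0\<close> there are no axis tiles, but \<open>zspace 0\<close>
    is a point. A positive \<open>J\<close> ensures \<open>n \<le> n * J\<close>.\<close>
  have "J \<noteq> 0"
  proof
    assume "J = 0"
    then have "axis_tiles A J = {}" unfolding axis_tiles_def by simp
    then have "zspace J = {}" using J unfolding tileable_def by auto
    then show False unfolding zspace_def by auto
  qed
  then have "n \<le> n * J" by simp
  moreover have "tiles T (n * J)"
    by (rule tiles_if_axis_tileable[OF T(3) c A_def[unfolded \<phi>_def] J])
  ultimately show ?thesis by blast
qed

end
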